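(* Let $m,n\geq1$ be integers with $m\neq n$. Then no $C^*$-algebra isomorphism between $\mathcal O_2^{\otimes m}$ and $\mathcal O_2^{\otimes n}$ preserves the canonical Cartan subalgebras; that is, there is no $*$-isomorphism $\varphi\colon\mathcal O_2^{\otimes m}\to\mathcal O_2^{\otimes n}$ with $\varphi(D_2^{\otimes m})=D_2^{\otimes n}$.
   Context: $\mathcal O_2$ is the Cuntz $C^*$-algebra, the universal unital $C^*$-algebra generated by isometries $s_1,s_2$ with $s_1s_1^*+s_2s_2^*=1$. Its canonical Cartan subalgebra $D_2$ is the closed linear span of the projections $s_\mu s_\mu^*$, where $\mu=(\mu_1,\ldots,\mu_k)$ ranges over finite words in $\{1,2\}$ and $s_\mu=s_{\mu_1}\cdots s_{\mu_k}$. $\mathcal O_2^{\otimes n}$ is the $n$-fold $C^*$-algebraic tensor product (unique, as $\mathcal O_2$ is nuclear), with canonical Cartan subalgebra $D_2^{\otimes n}$. *)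

theory Defs
  imports "HOL-Analysis.Analysis" "HOL-Library.Poly_Mapping"
begin

section \<open>Unital C*-algebras\<close>

text \<open>The distribution has only real normed algebras, so the complex scalar multiplication and
  the involution are added to a unital real Banach algebra. The class axiom
  \<open>norm 1 = 1\<close> inherited from \<^class>\<open>real_normed_algebra_1\<close> just excludes the
  zero algebra.\<close>

class unital_cstar_algebra = real_normed_algebra_1 + banach +
  fixes scaleC :: "complex \<Rightarrow> 'a \<Rightarrow> 'a" (infixr \<open>*\<^sub>C\<close> 75)
    and star :: "'a \<Rightarrow> 'a"
  assumes scaleC_add_right: "c *\<^sub>C (x + y) = c *\<^sub>C x + c *\<^sub>C y"
    and scaleC_add_left: "(c + d) *\<^sub>C x = c *\<^sub>C x + d *\<^sub>C x"
    and scaleC_scaleC: "c *\<^sub>C d *\<^sub>C x = (c * d) *\<^sub>C x"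
    and scaleC_of_real: "of_real r *\<^sub>C x = r *\<^sub>R x"
    and scaleC_mult_left: "(c *\<^sub>C x) * y = c *\<^sub>C (x * y)"
    and scaleC_mult_right: "x * (c *\<^sub>C y) = c *\<^sub>C (x * y)"
    and norm_scaleC: "norm (c *\<^sub>C x) = cmod c * norm x"
    and star_add: "star (x + y) = star x + star y"
    and star_scaleC: "star (c *\<^sub>C x) = cnj c *\<^sub>C star x"
    and star_mult: "star (x * y) = star y * star x"
    and star_star: "star (star x) = x"
    and cstar_identity: "norm (star x * x) = (norm x)\<^sup>2"

lemma scaleC_one: "1 *\<^sub>C x = (x :: 'a :: unital_cstar_algebra)"
  using scaleC_of_real[of 1 x] by simp

global_interpretation complex_vector:
  vector_space "scaleC :: complex \<Rightarrow> 'a \<Rightarrow> 'a :: unital_cstar_algebra"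
  defines cspan = complex_vector.span
  by unfold_locales (simp_all add: scaleC_add_right scaleC_add_left scaleC_scaleC scaleC_one)

definition star_hom :: "('a :: unital_cstar_algebra \<Rightarrow> 'b :: unital_cstar_algebra) \<Rightarrow> bool" where
  "star_hom \<phi> \<longleftrightarrow>
     (\<forall>x y. \<phi> (x + y) = \<phi> x + \<phi> y) \<and>
     (\<forall>c x. \<phi> (c *\<^sub>C x) = c *\<^sub>C \<phi> x) \<and>
     (\<forall>x y. \<phi> (x * y) = \<phi> x * \<phi> y) \<and>
     (\<forall>x. \<phi> (star x) = star (\<phi> x))"

definition star_isomorphism ::
    "('a :: unital_cstar_algebra \<Rightarrow> 'b :: unital_cstar_algebra) \<Rightarrow> bool" where
  "star_isomorphism \<phi> \<longleftrightarrow> star_hom \<phi> \<and> bij \<phi>"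

text \<open>\<open>'k \<Rightarrow>\<^sub>0 complex\<close> is the complex vector space with basis \<open>'k\<close>; \<open>linear_ext h\<close>
  is the linear map sending the basis vector \<open>k\<close> to \<open>h k\<close>.\<close>

definition linear_ext :: "('k \<Rightarrow> 'a :: unital_cstar_algebra) \<Rightarrow> ('k \<Rightarrow>\<^sub>0 complex) \<Rightarrow> 'a" where
  "linear_ext h f = (\<Sum>k\<in>Poly_Mapping.keys f. Poly_Mapping.lookup f k *\<^sub>C h k)"


section \<open>The free unital *-algebra on a set of generators\<close>

text \<open>A letter \<open>(g, False)\<close> stands for the generator \<open>g\<close>, a letter \<open>(g, True)\<close> for its adjoint.
  Words are written additively because the convolution product of
  \<^theory>\<open>HOL-Library.Poly_Mapping\<close> is based on an additive monoid of exponents; so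
  \<open>'g star_word \<Rightarrow>\<^sub>0 complex\<close> with its library ring structure is the algebra of noncommutative
  polynomials in the generators and their formal adjoints.\<close>

datatype 'g star_word = Word (letters: "('g \<times> bool) list")

instantiation star_word :: (type) monoid_add
begin

definition zero_star_word :: "'a star_word" where
  "0 = Word []"

definition plus_star_word :: "'a star_word \<Rightarrow> 'a star_word \<Rightarrow> 'a star_word" where
  "v + w = Word (letters v @ letters w)"

instance
  by standard (simp_all add: zero_star_word_def plus_star_word_def)

end

type_synonym 'g free_star_algebra = "'g star_word \<Rightarrow>\<^sub>0 complex"

definition free_gen :: "'g \<Rightarrow> 'g free_star_algebra" where
  "free_gen g = Poly_Mapping.single (Word [(g, False)]) 1"

definition word_star :: "'g star_word \<Rightarrow> 'g star_word" where
  "word_star w = Word (rev (map (\<lambda>(g, b). (g, \<not> b)) (letters w)))"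

definition free_star :: "'g free_star_algebra \<Rightarrow> 'g free_star_algebra" where
  "free_star f =
     (\<Sum>w\<in>Poly_Mapping.keys f. Poly_Mapping.single (word_star w) (cnj (Poly_Mapping.lookup f w)))"

definition word_eval :: "('g \<Rightarrow> 'a :: unital_cstar_algebra) \<Rightarrow> 'g star_word \<Rightarrow> 'a" where
  "word_eval t w = prod_list (map (\<lambda>(g, b). if b then star (t g) else t g) (letters w))"

definition free_eval :: "('g \<Rightarrow> 'a :: unital_cstar_algebra) \<Rightarrow> 'g free_star_algebra \<Rightarrow> 'a" where
  "free_eval t = linear_ext (word_eval t)"

definition cstar_seminorm :: "('g free_star_algebra \<Rightarrow> real) \<Rightarrow> bool" where
  "cstar_seminorm p \<longleftrightarrow>
     (\<forall>f g. p (f + g) \<le> p f + p g) \<and>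
     (\<forall>c f. p (Poly_Mapping.map ((*) c) f) = cmod c * p f) \<and>
     (\<forall>f g. p (f * g) \<le> p f * p g) \<and>
     (\<forall>f. p (free_star f * f) = (p f)\<^sup>2)"


section \<open>The Cuntz algebra and its diagonal\<close>

datatype cuntz_index = I1 | I2

definition cuntz_family :: "(cuntz_index \<Rightarrow> 'a :: unital_cstar_algebra) \<Rightarrow> bool" where
  "cuntz_family s \<longleftrightarrow>
     star (s I1) * s I1 = 1 \<and> star (s I2) * s I2 = 1 \<and>
     s I1 * star (s I1) + s I2 * star (s I2) = 1"

definition cuntz_relators :: "cuntz_index free_star_algebra set" where
  "cuntz_relators =
     {free_star (free_gen I1) * free_gen I1 - 1,
      free_star (free_gen I2) * free_gen I2 - 1,
      free_gen I1 * free_star (free_gen I1) + free_gen I2 * free_star (free_gen I2) - 1}"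

text \<open>The type \<open>'a\<close>, with the elements \<open>s I1\<close>, \<open>s I2\<close>, is the universal unital C*-algebra for
  the Cuntz relations: the completion of the free unital *-algebra with respect to the largest
  C*-seminorm that annihilates the relators. The last conjunct cannot be written as a
  quantification over all C*-algebras, since HOL has no quantifier over types; the mapping
  property it stands for is lemma \<open>cuntz_algebra_universal\<close> below.\<close>

definition is_cuntz_algebra :: "(cuntz_index \<Rightarrow> 'a :: unital_cstar_algebra) \<Rightarrow> bool" where
  "is_cuntz_algebra s \<longleftrightarrow>
     cuntz_family s \<and>
     closure (range (free_eval s)) = UNIV \<and>
     (\<forall>p. cstar_seminorm p \<and> (\<forall>r\<in>cuntz_relators. p r = 0) \<longrightarrow>
          (\<forall>f. p f \<le> norm (free_eval s f)))"

lemma linear_ext_superset: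
  assumes "finite K" "Poly_Mapping.keys f \<subseteq> K"
  shows "linear_ext h f = (\<Sum>k\<in>K. Poly_Mapping.lookup f k *\<^sub>C h k)"
  unfolding linear_ext_def using assms
  by (intro sum.mono_neutral_left) (auto simp: in_keys_iff complex_vector.scale_zero_left)

lemma linear_ext_add: "linear_ext h (f + g) = linear_ext h f + linear_ext h g"
proof -
  let ?K = "Poly_Mapping.keys f \<union> Poly_Mapping.keys g"
  have "linear_ext h (f + g) = (\<Sum>k\<in>?K. Poly_Mapping.lookup (f + g) k *\<^sub>C h k)"
    by (intro linear_ext_superset) (use keys_add[of f g] in auto)
  also have "\<dots> = (\<Sum>k\<in>?K. Poly_Mapping.lookup f k *\<^sub>C h k)
                + (\<Sum>k\<in>?K. Poly_Mapping.lookup g k *\<^sub>C h k)"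
    by (simp add: lookup_add scaleC_add_left sum.distrib)
  also have "\<dots> = linear_ext h f + linear_ext h g"
    by (intro arg_cong2[where f = "(+)"] linear_ext_superset[symmetric]) auto
  finally show ?thesis .
qed

lemma linear_ext_single: "linear_ext h (Poly_Mapping.single k c) = c *\<^sub>C h k"
  using linear_ext_superset[of "{k}" "Poly_Mapping.single k c" h] by (simp split: if_splits)

lemma linear_ext_zero: "linear_ext h 0 = 0"
  by (simp add: linear_ext_def)

lemma linear_ext_diff: "linear_ext h (f - g) = linear_ext h f - linear_ext h g"
  using linear_ext_add[of h "f - g" g] by simp

lemma linear_ext_scale: "linear_ext h (Poly_Mapping.map ((*) c) f) = c *\<^sub>C linear_ext h f"
proof -
  have "linear_ext h (Poly_Mapping.map ((*) c) f)
      = (\<Sum>k\<in>Poly_Mapping.keys f. Poly_Mapping.lookup (Poly_Mapping.map ((*) c) f) k *\<^sub>C h k)"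
    by (intro linear_ext_superset) (auto simp: in_keys_iff map.rep_eq when_def)
  also have "\<dots> = (\<Sum>k\<in>Poly_Mapping.keys f. c *\<^sub>C Poly_Mapping.lookup f k *\<^sub>C h k)"
    by (intro sum.cong) (auto simp: map.rep_eq when_def in_keys_iff scaleC_scaleC)
  also have "\<dots> = c *\<^sub>C linear_ext h f"
    by (simp add: linear_ext_def complex_vector.scale_sum_right)
  finally show ?thesis .
qed

lemma linear_ext_sum: "linear_ext h (\<Sum>i\<in>I. F i) = (\<Sum>i\<in>I. linear_ext h (F i))"
  by (induction I rule: infinite_finite_induct) (simp_all add: linear_ext_zero linear_ext_add)

lemma free_induct [case_names single add]:
  assumes "\<And>w c. P (Poly_Mapping.single w c)" and "\<And>f g. P f \<Longrightarrow> P g \<Longrightarrow> P (f + g)"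
  shows "P (f :: 'k \<Rightarrow>\<^sub>0 complex)"
proof (induction f rule: update_induct)
  case const
  show ?case using assms(1)[of undefined 0] by simp
next
  case (update f a b)
  have "Poly_Mapping.update a b f = f + Poly_Mapping.single a b"
    using update by (intro poly_mapping_eqI)
      (auto simp: lookup_update lookup_add lookup_single in_keys_iff when_def)
  with update assms show ?case by metis
qed

lemma star_zero: "star (0 :: 'a :: unital_cstar_algebra) = 0"
  using star_add[of "0 :: 'a" 0] by simp

lemma star_one: "star (1 :: 'a :: unital_cstar_algebra) = 1"
  using star_mult[of "star (1 :: 'a)" 1] by (simp add: star_star)

lemma star_sum: "star (\<Sum>i\<in>I. F i) = (\<Sum>i\<in>I. star (F i :: 'a :: unital_cstar_algebra))"
  by (induction I rule: infinite_finite_induct) (simp_all add: star_zero star_add)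

lemma norm_star: "norm (star x) = norm (x :: 'a :: unital_cstar_algebra)"
proof -
  have le: "norm y \<le> norm (star y)" for y :: 'a
  proof (cases "y = 0")
    case False
    have "norm y * norm y \<le> norm (star y) * norm y"
      using cstar_identity[of y] norm_mult_ineq[of "star y" y] by (simp add: power2_eq_square)
    with False show ?thesis by simp
  qed (simp add: star_zero)
  from le[of x] le[of "star x"] show ?thesis by (simp add: star_star)
qed

lemma word_eval_zero: "word_eval t 0 = 1"
  by (simp add: word_eval_def zero_star_word_def)

lemma word_eval_add: "word_eval t (v + w) = word_eval t v * word_eval t w"
  by (simp add: word_eval_def plus_star_word_def)

lemma star_prod_list:
  "star (prod_list xs) = prod_list (rev (map star (xs :: 'a :: unital_cstar_algebra list)))"
  by (induction xs) (simp_all add: star_one star_mult)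

lemma word_eval_star: "word_eval t (word_star w) = star (word_eval t w)"
  by (simp add: word_eval_def word_star_def star_prod_list rev_map comp_def case_prod_unfold star_star
      if_distrib cong: if_cong) (intro arg_cong[where f = prod_list] map_cong, auto simp: star_star)

lemma free_eval_one: "free_eval t 1 = 1"
  unfolding free_eval_def single_one[symmetric]
  by (simp only: linear_ext_single word_eval_zero scaleC_one)

lemma free_eval_gen: "free_eval t (free_gen g) = t g"
  by (simp add: free_eval_def free_gen_def linear_ext_single scaleC_one word_eval_def)

lemma free_eval_mult: "free_eval t (f * g) = free_eval t f * free_eval t g"
proof (induction f rule: free_induct)
  case (single v c)
  show ?case
  proof (induction g rule: free_induct)
    case (single w d)
    show ?case
      by (simp add: free_eval_def mult_single linear_ext_single word_eval_add scaleC_mult_left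
          scaleC_mult_right scaleC_scaleC)
  qed (simp add: free_eval_def linear_ext_add algebra_simps)
qed (simp add: free_eval_def linear_ext_add algebra_simps)

lemma free_eval_star: "free_eval t (free_star f) = star (free_eval t f)"
  by (simp add: free_eval_def free_star_def linear_ext_sum linear_ext_single word_eval_star)
    (simp add: linear_ext_def star_sum star_scaleC)

lemma cstar_seminorm_free_eval: "cstar_seminorm (\<lambda>f. norm (free_eval t f))"
  unfolding cstar_seminorm_def free_eval_mult free_eval_star
  by (auto simp: free_eval_def linear_ext_add linear_ext_scale norm_scaleC norm_triangle_ineq
      norm_mult_ineq cstar_identity)

lemma cuntz_relators_free_eval:
  assumes "cuntz_family t" "r \<in> cuntz_relators"
  shows "free_eval t r = 0"
proof -
  have add: "free_eval t (f + g) = free_eval t f + free_eval t g"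
    and diff: "free_eval t (f - g) = free_eval t f - free_eval t g" for f g
    by (simp_all add: free_eval_def linear_ext_add linear_ext_diff)
  show ?thesis using assms
    by (auto simp: cuntz_relators_def cuntz_family_def add diff free_eval_mult free_eval_star
        free_eval_gen free_eval_one)
qed

lemma continuous_on_scaleC: "continuous_on A (\<lambda>x :: 'a :: unital_cstar_algebra. c *\<^sub>C x)"
proof (rule lipschitz_on_continuous_on)
  show "(cmod c)-lipschitz_on A (\<lambda>x :: 'a. c *\<^sub>C x)"
    by (intro lipschitz_onI)
      (simp_all add: dist_norm complex_vector.scale_right_diff_distrib[symmetric] norm_scaleC)
qed

lemma star_diff: "star (x - y) = star x - star (y :: 'a :: unital_cstar_algebra)"
  using star_add[of "x - y" y] by simp

lemma continuous_on_star: "continuous_on A (star :: 'a :: unital_cstar_algebra \<Rightarrow> 'a)"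
proof (rule lipschitz_on_continuous_on)
  show "1-lipschitz_on A (star :: 'a \<Rightarrow> 'a)"
    by (intro lipschitz_onI) (simp_all add: dist_norm star_diff[symmetric] norm_star)
qed

text \<open>Continuity of *-homomorphisms is automatic by spectral theory; it is included here so that
  uniqueness can be shown without that theory.\<close>

theorem cuntz_algebra_universal:
  fixes s :: "cuntz_index \<Rightarrow> 'a :: unital_cstar_algebra"
    and t :: "cuntz_index \<Rightarrow> 'b :: unital_cstar_algebra"
  assumes "is_cuntz_algebra s" and "cuntz_family t"
  shows "\<exists>!\<psi>. star_hom \<psi> \<and> continuous_on UNIV \<psi> \<and> \<psi> 1 = 1 \<and> (\<forall>i. \<psi> (s i) = t i)"
proof -
  let ?X = "range (free_eval s)"
  have dense: "closure ?X = UNIV"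
    using assms(1) by (simp add: is_cuntz_algebra_def)
  have dom: "norm (free_eval t f) \<le> norm (free_eval s f)" for f
    using assms cstar_seminorm_free_eval[of t] cuntz_relators_free_eval[OF assms(2)]
    unfolding is_cuntz_algebra_def by auto
  have lin: "free_eval u (f + g) = free_eval u f + free_eval u g"
    "free_eval u (f - g) = free_eval u f - free_eval u g"
    "free_eval u (Poly_Mapping.map ((*) c) f) = c *\<^sub>C free_eval u f"
    for u :: "cuntz_index \<Rightarrow> 'x :: unital_cstar_algebra" and f g c
    by (simp_all add: free_eval_def linear_ext_add linear_ext_diff linear_ext_scale)
  define g where "g x = free_eval t (inv (free_eval s) x)" for x
  have g_eval: "g (free_eval s f) = free_eval t f" for f
  proof -
    let ?f = "inv (free_eval s) (free_eval s f)"
    have "free_eval s ?f = free_eval s f" by (simp add: f_inv_into_f)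
    then have "norm (free_eval t (?f - f)) \<le> 0"
      using dom[of "?f - f"] by (simp add: lin)
    then show ?thesis by (simp add: g_def lin)
  qed
  have "1-lipschitz_on ?X g"
  proof (intro lipschitz_onI)
    fix x y assume "x \<in> ?X" "y \<in> ?X"
    then obtain f h where "x = free_eval s f" "y = free_eval s h" by blast
    then show "dist (g x) (g y) \<le> 1 * dist x y"
      using dom[of "f - h"] by (simp add: g_eval dist_norm lin)
  qed simp
  then obtain \<psi> where cont: "continuous_on UNIV \<psi>" and ext: "\<And>x. x \<in> ?X \<Longrightarrow> g x = \<psi> x"
    using uniformly_continuous_on_extension_on_closure[OF lipschitz_on_uniformly_continuous]
      uniformly_continuous_imp_continuous dense by metis
  have psi: "\<psi> (free_eval s f) = free_eval t f" for f
    using ext[of "free_eval s f"] by (simp add: g_eval)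
  have ind1: "P x" if "closed {x. P x}" "\<And>f. P (free_eval s f)" for P x
  proof -
    have "closure ?X \<subseteq> {x. P x}" using that by (intro closure_minimal) auto
    then show ?thesis using dense by auto
  qed
  have cont': "continuous_on A (\<lambda>x. \<psi> (h x))" if "continuous_on A h"
    for A :: "'a set" and h
    using continuous_on_compose2[OF cont that] by simp
  have star': "continuous_on A (\<lambda>x. star (h x))" if "continuous_on A h"
    for A :: "'a set" and h :: "'a \<Rightarrow> 'x :: unital_cstar_algebra"
    using continuous_on_compose2[OF continuous_on_star that] by blast
  have scale': "continuous_on A (\<lambda>x. c *\<^sub>C h x)" if "continuous_on A h"
    for A :: "'a set" and h :: "'a \<Rightarrow> 'x :: unital_cstar_algebra" and c
    using continuous_on_compose2[OF continuous_on_scaleC that] by blast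
  note conts = cont' star' scale' continuous_on_add continuous_on_mult continuous_on_const
    continuous_on_id
  have "\<psi> (x + y) = \<psi> x + \<psi> y" for x y
  proof (rule ind1[of "\<lambda>x. \<psi> (x + y) = \<psi> x + \<psi> y"])
    show "closed {x. \<psi> (x + y) = \<psi> x + \<psi> y}"
      by (intro closed_Collect_eq conts)
    show "\<psi> (free_eval s f + y) = \<psi> (free_eval s f) + \<psi> y" for f
      by (rule ind1[of "\<lambda>y. \<psi> (free_eval s f + y) = \<psi> (free_eval s f) + \<psi> y"],
          (intro closed_Collect_eq conts)[1],
        simp add: psi flip: lin)
  qed
  moreover have "\<psi> (x * y) = \<psi> x * \<psi> y" for x y
  proof (rule ind1[of "\<lambda>x. \<psi> (x * y) = \<psi> x * \<psi> y"])
    show "closed {x. \<psi> (x * y) = \<psi> x * \<psi> y}"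
      by (intro closed_Collect_eq conts)
    show "\<psi> (free_eval s f * y) = \<psi> (free_eval s f) * \<psi> y" for f
      by (rule ind1[of "\<lambda>y. \<psi> (free_eval s f * y) = \<psi> (free_eval s f) * \<psi> y"],
          (intro closed_Collect_eq conts)[1],
        simp add: psi flip: free_eval_mult)
  qed
  moreover have "\<psi> (c *\<^sub>C x) = c *\<^sub>C \<psi> x" for c x
    by (rule ind1[of "\<lambda>x. \<psi> (c *\<^sub>C x) = c *\<^sub>C \<psi> x"], (intro closed_Collect_eq conts)[1],
      simp add: psi flip: lin)
  moreover have "\<psi> (star x) = star (\<psi> x)" for x
    by (rule ind1[of "\<lambda>x. \<psi> (star x) = star (\<psi> x)"], (intro closed_Collect_eq conts)[1],
      simp add: psi flip: free_eval_star)
  moreover have "\<psi> 1 = 1" "\<psi> (s i) = t i" for i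
    using psi[of 1] psi[of "free_gen i"] by (simp_all add: free_eval_one free_eval_gen)
  ultimately have ex: "star_hom \<psi> \<and> continuous_on UNIV \<psi> \<and> \<psi> 1 = 1 \<and> (\<forall>i. \<psi> (s i) = t i)"
    using cont by (simp add: star_hom_def)
  have "\<theta> = \<psi>" if th: "star_hom \<theta>" "continuous_on UNIV \<theta>" "\<theta> 1 = 1" "\<forall>i. \<theta> (s i) = t i" for \<theta>
  proof
    fix x
    have hom: "\<theta> (x + y) = \<theta> x + \<theta> y" "\<theta> (c *\<^sub>C x) = c *\<^sub>C \<theta> x" "\<theta> (x * y) = \<theta> x * \<theta> y"
      "\<theta> (star x) = star (\<theta> x)" for x y c
      using th(1) by (auto simp: star_hom_def)
    have "\<theta> (word_eval s (Word w)) = word_eval t (Word w)" for w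
      by (induction w) (use th in \<open>auto simp: word_eval_def hom\<close>)
    then have word: "\<theta> (word_eval s w) = word_eval t w" for w
      by (cases w) simp
    have eval: "\<theta> (free_eval s f) = free_eval t f" for f
      by (induction f rule: free_induct)
        (simp_all add: lin hom, simp add: free_eval_def linear_ext_single hom word)
    show "\<theta> x = \<psi> x"
      by (rule ind1[of "\<lambda>x. \<theta> x = \<psi> x", OF closed_Collect_eq[OF th(2) cont]])
        (simp add: psi eval)
  qed
  with ex show ?thesis by blast
qed

definition cuntz_word :: "(cuntz_index \<Rightarrow> 'a :: unital_cstar_algebra) \<Rightarrow> cuntz_index list \<Rightarrow> 'a" where
  "cuntz_word s \<mu> = prod_list (map s \<mu>)"

definition cuntz_diagonal :: "(cuntz_index \<Rightarrow> 'a :: unital_cstar_algebra) \<Rightarrow> 'a set" where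
  "cuntz_diagonal s = closure (cspan (range (\<lambda>\<mu>. cuntz_word s \<mu> * star (cuntz_word s \<mu>))))"


section \<open>Tensor powers of a unital C*-algebra\<close>

text \<open>The algebraic tensor power of \<open>'a\<close> is the vector space of formal linear combinations of
  \<open>n\<close>-tuples (lists of length \<open>n\<close>) modulo the span of the relations making the tuples
  multilinear.\<close>

definition multilinear_relators :: "nat \<Rightarrow> ('a :: unital_cstar_algebra list \<Rightarrow>\<^sub>0 complex) set" where
  "multilinear_relators n =
     {Poly_Mapping.single (xs[i := x + y]) 1
        - Poly_Mapping.single (xs[i := x]) 1 - Poly_Mapping.single (xs[i := y]) 1
      | xs i x y. length xs = n \<and> i < n} \<union>
     {Poly_Mapping.single (xs[i := c *\<^sub>C x]) 1 - Poly_Mapping.single (xs[i := x]) c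
      | xs i c x. length xs = n \<and> i < n}"

lemma lookup_scale:
  "Poly_Mapping.lookup (Poly_Mapping.map ((*) c) f) k = c * (Poly_Mapping.lookup f k :: complex)"
  by (simp add: map.rep_eq when_def)

global_interpretation formal_sum:
  vector_space "\<lambda>c. Poly_Mapping.map ((*) c) :: ('k \<Rightarrow>\<^sub>0 complex) \<Rightarrow> _"
  defines formal_span = formal_sum.span
  by unfold_locales
    (auto intro!: poly_mapping_eqI simp: lookup_scale lookup_add algebra_simps)

text \<open>\<open>\<iota> i x\<close> is \<open>1 \<otimes> \<dots> \<otimes> x \<otimes> \<dots> \<otimes> 1\<close> with \<open>x\<close> in position \<open>i\<close> (counted from 0).\<close>

definition elementary_tensor ::
    "(nat \<Rightarrow> 'a \<Rightarrow> 'b :: unital_cstar_algebra) \<Rightarrow> 'a list \<Rightarrow> 'b" where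
  "elementary_tensor \<iota> xs = prod_list (map (\<lambda>i. \<iota> i (xs ! i)) [0..<length xs])"

text \<open>The type \<open>'b\<close>, with the factor embeddings \<open>\<iota> 0, \<dots>, \<iota> (n - 1)\<close>, is a C*-tensor product of
  \<open>n\<close> copies of the C*-algebra \<open>'a\<close>: it contains the algebraic tensor power as a dense
  *-subalgebra, i.e. it is the completion of the algebraic tensor power in some C*-norm.
  For nuclear \<open>'a\<close> there is only one such norm, so that this determines \<open>'b\<close>.\<close>

definition is_cstar_tensor_power ::
    "nat \<Rightarrow> (nat \<Rightarrow> 'a :: unital_cstar_algebra \<Rightarrow> 'b :: unital_cstar_algebra) \<Rightarrow> bool" where
  "is_cstar_tensor_power n \<iota> \<longleftrightarrow>
     (\<forall>i<n. star_hom (\<iota> i) \<and> \<iota> i 1 = 1) \<and>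
     (\<forall>i<n. \<forall>j<n. i \<noteq> j \<longrightarrow> (\<forall>x y. \<iota> i x * \<iota> j y = \<iota> j y * \<iota> i x)) \<and>
     (\<forall>f. Poly_Mapping.keys f \<subseteq> {xs. length xs = n} \<and> linear_ext (elementary_tensor \<iota>) f = 0 \<longrightarrow>
          f \<in> formal_span (multilinear_relators n)) \<and>
     closure (cspan (elementary_tensor \<iota> ` {xs. length xs = n})) = UNIV"

definition tensor_power_subspace ::
    "nat \<Rightarrow> (nat \<Rightarrow> 'a \<Rightarrow> 'b :: unital_cstar_algebra) \<Rightarrow> 'a set \<Rightarrow> 'b set" where
  "tensor_power_subspace n \<iota> D =
     closure (cspan (elementary_tensor \<iota> ` {xs. length xs = n \<and> set xs \<subseteq> D}))"

end

theory Submission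
  imports Defs
begin

text \<open>The tensor power \<open>\<O>\<^sub>2\<^sup>\<otimes>\<^sup>m\<close> is generated by \<open>m\<close> commuting Cuntz families. A unitary normalizing its
  diagonal agrees up to an error below \<open>1/2\<close> with a finite combination of the words
  \<open>s\<^bsub>\<mu>\<^esub>s\<^bsub>\<nu>\<^esub>\<^sup>*\<close>, and on a small cylinder exactly one coefficient of that combination exceeds
  \<open>1/2\<close>; so the unitary acts on the cylinder by a prefix replacement \<open>\<nu>\<eta> \<mapsto> \<mu>\<eta>\<close>. If it fixes a point
  \<open>x\<close> of the spectrum of the diagonal, then the differences \<open>\<bar>\<mu>\<^sub>i\<bar> - \<bar>\<nu>\<^sub>i\<bar>\<close> form a degree in
  \<open>\<int>\<^sup>m\<close>, which is additive and determines the action near \<open>x\<close>. Hence among any \<open>n > m\<close> commuting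
  normalizing unitaries fixing \<open>x\<close> two different monomials act identically near \<open>x\<close>. In
  \<open>\<O>\<^sub>2\<^sup>\<otimes>\<^sup>n\<close>, however, copies of a generator of Thompson's group in the \<open>n\<close> tensor factors fix
  \<open>(111\<dots>, \<dots>, 111\<dots>)\<close> and all their monomials act differently near that point.\<close>

section \<open>Contractivity of *-homomorphisms and multipliers of closed subspaces\<close>

text \<open>In groupoid language the proof compares isotropy groups: for \<open>m\<close> factors
  they embed in \<open>\<int>\<^sup>m\<close>, and over \<open>111...\<close> in \<open>n\<close>
  factors the isotropy has rank \<open>n\<close>. No groupoid is reconstructed: clopen sets are the
  self-adjoint idempotents of the diagonal and points are ultrafilters of them, so both can be
  carried along the isomorphism. The main obstacle is that words occurring in an approximation may
  be prefixes of one another; then their ranges overlap and no coefficient can be isolated. A marker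
  \<open>11...12\<close> appended to all of them makes the ranges orthogonal, and the resulting
  statement about marked cylinders extends to all cylinders because every cylinder contains a marked
  one. The bound \<open>1/2\<close> lets one compression force a coefficient above it and a
  complementary one force it below. The argument is asymmetric: relations come from the algebra with
  fewer factors, explicit unitaries from the one with more, so for \<open>n < m\<close> the inverse
  isomorphism is used.\<close>

lemma star_scaleR: "star (r *\<^sub>R x) = r *\<^sub>R star (x :: 'a :: unital_cstar_algebra)"
  by (metis scaleC_of_real star_scaleC complex_cnj_complex_of_real)

lemma closed_selfadjoint: "closed {x :: 'a :: unital_cstar_algebra. star x = x}"
  by (intro closed_Collect_eq continuous_on_star continuous_on_id)

text \<open>A substitute for functional calculus: \<open>b = 1 - c\<close> is a square root of
  \<open>1 - h * h\<close>, where \<open>c\<close> is the fixed point of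
  \<open>c \<mapsto> (h * h + c * c) / 2\<close>. On the ball of radius
  \<open>norm (h * h) < 1\<close> this map is a contraction, and it preserves self-adjointness and
  commutation with \<open>h\<close>.\<close>

lemma selfadjoint_circle:
  fixes h :: "'a :: unital_cstar_algebra"
  assumes h: "star h = h" "norm h < 1"
  obtains b where "star b = b" "h * b = b * h" "h * h + b * b = 1"
proof -
  define g where "g = h * h"
  have g1: "norm g < 1"
    using cstar_identity[of h] h by (simp add: g_def power_less_one_iff abs_square_less_1)
  define X where "X = {c :: 'a. norm c \<le> norm g} \<inter> {c. star c = c} \<inter> {c. h * c = c * h}"
  define F where "F c = (1/2) *\<^sub>R (g + c * c)" for c :: 'a
  have "closed X" unfolding X_def
    by (intro closed_Int closed_selfadjoint closed_Collect_eq closed_Collect_le continuous_intros)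
  then have 1: "complete X" by (simp add: complete_eq_closed)
  have 2: "0 \<in> X" by (simp add: X_def star_zero)
  have 3: "F ` X \<subseteq> X"
  proof safe
    fix c assume "c \<in> X"
    then have c: "norm c \<le> norm g" "star c = c" "h * c = c * h" by (auto simp: X_def)
    have "norm (g + c * c) \<le> norm g + norm c * norm c"
      using norm_triangle_ineq[of g "c * c"] norm_mult_ineq[of c c] by linarith
    also have "norm c * norm c \<le> norm g * 1"
      by (intro mult_mono) (use c g1 in auto)
    finally have "norm (F c) \<le> norm g" by (simp add: F_def)
    moreover have "star (F c) = F c"
      using c h by (simp add: F_def star_scaleR star_add star_mult g_def)
    moreover have "h * (c * c) = c * c * h" using c(3) by (metis mult.assoc)
    then have "h * F c = F c * h" by (simp add: F_def g_def algebra_simps)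
    ultimately show "F c \<in> X" by (simp add: X_def)
  qed
  have 4: "dist (F c) (F d) \<le> norm g * dist c d" if "c \<in> X" "d \<in> X" for c d
  proof -
    have cd: "norm c \<le> norm g" "norm d \<le> norm g" using that by (auto simp: X_def)
    have "F c - F d = (1/2) *\<^sub>R (c * (c - d) + (c - d) * d)"
      by (simp add: F_def algebra_simps)
    then have "dist (F c) (F d) = norm (c * (c - d) + (c - d) * d) / 2"
      by (simp add: dist_norm)
    also have "\<dots> \<le> (norm c * norm (c - d) + norm (c - d) * norm d) / 2"
      by (intro divide_right_mono order_trans[OF norm_triangle_ineq] add_mono norm_mult_ineq) auto
    also have "\<dots> \<le> (norm g * norm (c - d) + norm (c - d) * norm g) / 2"
      by (intro divide_right_mono add_mono mult_left_mono mult_right_mono cd) auto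
    finally show ?thesis by (simp add: dist_norm mult.commute)
  qed
  have "\<exists>!c\<in>X. F c = c"
    by (rule Banach_fix[OF 1 _ norm_ge_zero g1 3 4]) (use 2 in blast)
  then obtain c where c: "c \<in> X" "F c = c" by blast
  have "2 *\<^sub>R F c = g + c * c" by (simp add: F_def)
  with c have g: "g = 2 *\<^sub>R c - c * c" by simp
  have "(1 - c) * (1 - c) = 1 - g" unfolding g by (simp add: algebra_simps scaleR_2)
  then have "h * h + (1 - c) * (1 - c) = 1" by (simp add: g_def)
  with c show ?thesis
    by (intro that[of "1 - c"]) (auto simp: X_def star_diff star_one algebra_simps)
qed

text \<open>\<open>h\<close> is the real part of \<open>h + \<i> *\<^sub>C b\<close>, which the
  hypotheses make an isometry of norm 1.\<close>

lemma norm_le_one_if_circle: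
  fixes h b :: "'a :: unital_cstar_algebra"
  assumes "star h = h" "star b = b" "h * b = b * h" "h * h + b * b = 1"
  shows "norm h \<le> 1"
proof -
  define z where "z = h + \<i> *\<^sub>C b"
  have sz: "star z = h - \<i> *\<^sub>C b"
    using assms by (simp add: z_def star_add star_scaleC complex_vector.scale_minus_left)
  have "star z * z = h * h + b * b" unfolding sz unfolding z_def
    using assms(3) by (simp add: algebra_simps scaleC_mult_left scaleC_mult_right scaleC_scaleC
        complex_vector.scale_minus_left scaleC_one)
  then have "(norm z)\<^sup>2 = 1" using cstar_identity[of z] assms(4) by simp
  then have "norm z = 1" using norm_ge_zero[of z] by (auto simp: power2_eq_1_iff simp del: norm_ge_zero)
  moreover have "2 *\<^sub>R h = z + star z" unfolding sz unfolding z_def by (simp add: scaleR_2)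
  then have "2 * norm h \<le> norm z + norm (star z)"
    by (metis norm_scaleR norm_triangle_ineq abs_numeral)
  ultimately show ?thesis by (simp add: norm_star)
qed

lemma star_hom_scaleR: "star_hom \<phi> \<Longrightarrow> \<phi> (r *\<^sub>R x) = r *\<^sub>R \<phi> x"
  unfolding star_hom_def by (metis scaleC_of_real)

text \<open>The circle equation is algebraic, so \<open>\<phi>\<close> carries it over; this bounds
  self-adjoint elements after scaling, and the C*-identity handles the rest. Continuity of the
  factor embeddings \<open>\<iota> i\<close>, given as unital *-homomorphisms, comes from
  here.\<close>

lemma star_hom_contractive:
  assumes hom: "star_hom \<phi>" and one: "\<phi> 1 = 1"
  shows "norm (\<phi> x) \<le> norm x"
proof -
  have sa1: "norm (\<phi> h) \<le> 1" if h: "star h = h" "norm h < 1" for h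
  proof -
    obtain b where b: "star b = b" "h * b = b * h" "h * h + b * b = 1"
      using selfadjoint_circle[OF h] .
    show ?thesis
      by (rule norm_le_one_if_circle[of _ "\<phi> b"])
        (use hom one h b in \<open>metis star_hom_def\<close>)+
  qed
  have sa: "norm (\<phi> h) \<le> norm h" if h: "star h = h" for h
  proof (rule field_le_epsilon)
    fix e :: real assume e: "0 < e"
    \<comment> \<open>The slack \<open>e\<close> gives the rescaled element norm strictly below 1,
      as \<open>selfadjoint_circle\<close> requires.\<close>
    define r where "r = norm h + e"
    have r: "r > 0" "norm h < r" using e by (auto simp: r_def intro: add_nonneg_pos)
    have "norm (\<phi> ((1/r) *\<^sub>R h)) \<le> 1"
      by (rule sa1) (use r h in \<open>simp_all add: star_scaleR\<close>)
    then show "norm (\<phi> h) \<le> norm h + e"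
      using r by (simp add: star_hom_scaleR[OF hom] field_simps r_def)
  qed
  have "(norm (\<phi> x))\<^sup>2 = norm (\<phi> (star x * x))"
    using hom cstar_identity[of "\<phi> x"] by (simp add: star_hom_def)
  also have "\<dots> \<le> (norm x)\<^sup>2"
    using sa[of "star x * x"] by (simp add: star_mult star_star cstar_identity)
  finally show ?thesis by (rule power2_le_imp_le) simp
qed

lemma star_hom_diff: "star_hom \<phi> \<Longrightarrow> \<phi> (x - y) = \<phi> x - \<phi> y"
  unfolding star_hom_def by (metis add_diff_cancel_right' diff_add_cancel)

lemma star_hom_continuous:
  assumes "star_hom \<phi>" "\<phi> 1 = 1"
  shows "continuous_on A \<phi>"
proof (rule lipschitz_on_continuous_on)
  show "1-lipschitz_on A \<phi>"
    using star_hom_contractive[OF assms]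
    by (intro lipschitz_onI) (simp_all add: dist_norm star_hom_diff[OF assms(1), symmetric])
qed

section \<open>Norms of isometries and projections\<close>

lemma norm_isometry_mult:
  fixes x :: "'a :: unital_cstar_algebra"
  assumes "star x * x = 1"
  shows "norm (x * y) = norm y"
proof -
  have "star (x * y) * (x * y) = star y * y"
    using assms by (metis star_mult mult.assoc mult_1)
  then show ?thesis
    using cstar_identity[of "x * y"] cstar_identity[of y]
    by (metis norm_ge_zero power2_eq_imp_eq)
qed

lemma norm_projection:
  fixes q :: "'a :: unital_cstar_algebra"
  assumes "star q = q" "q * q = q" "q \<noteq> 0"
  shows "norm q = 1"
  using cstar_identity[of q] assms by (simp add: power2_eq_square)

lemma norm_projection_mult_le:
  fixes q :: "'a :: unital_cstar_algebra"
  assumes "star q = q" "q * q = q"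
  shows "norm (q * x) \<le> norm x" "norm (x * q) \<le> norm x"
proof -
  have "norm q \<le> 1" using norm_projection[OF assms] by (cases "q = 0") auto
  then show "norm (q * x) \<le> norm x" "norm (x * q) \<le> norm x"
    by (metis norm_mult_ineq mult_left_le_one_le mult_right_le_one_le norm_ge_zero order_trans)+
qed

section \<open>Closed complex spans and their left multipliers\<close>

lemma complex_subspace_closure:
  assumes "complex_vector.subspace (X :: 'a :: unital_cstar_algebra set)"
  shows "complex_vector.subspace (closure X)"
proof (rule complex_vector.subspaceI)
  show "0 \<in> closure X"
    using assms closure_subset complex_vector.subspace_0 by blast
next
  fix x y assume "x \<in> closure X" "y \<in> closure X"
  then obtain f g where "\<And>n::nat. f n \<in> X" "f \<longlonglongrightarrow> x" "\<And>n::nat. g n \<in> X" "g \<longlonglongrightarrow> y"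
    by (auto simp: closure_sequential)
  then show "x + y \<in> closure X"
    unfolding closure_sequential
    by (intro exI[of _ "\<lambda>n. f n + g n"]) (auto intro: tendsto_add complex_vector.subspace_add assms)
next
  fix c x assume x: "x \<in> closure X"
  have "(*\<^sub>C) c ` closure X \<subseteq> closure X"
    by (rule image_closure_subset[OF continuous_on_scaleC])
      (use assms closure_subset complex_vector.subspace_scale in blast)+
  with x show "c *\<^sub>C x \<in> closure X" by blast
qed

definition closed_cspan :: "'a :: unital_cstar_algebra set \<Rightarrow> 'a set" where
  "closed_cspan X = closure (cspan X)"

lemma closed_cspan_subspace: "complex_vector.subspace (closed_cspan X)"
  unfolding closed_cspan_def by (simp add: complex_subspace_closure)

lemma closed_closed_cspan: "closed (closed_cspan X)"
  by (simp add: closed_cspan_def)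

lemma closed_cspan_base: "x \<in> X \<Longrightarrow> x \<in> closed_cspan X"
  unfolding closed_cspan_def by (meson closure_subset complex_vector.span_base subsetD)

lemma closed_cspan_minimal:
  "X \<subseteq> Y \<Longrightarrow> complex_vector.subspace Y \<Longrightarrow> closed Y \<Longrightarrow> closed_cspan X \<subseteq> Y"
  unfolding closed_cspan_def by (simp add: closure_minimal complex_vector.span_minimal)

lemma closed_cspan_mult_left:
  assumes "\<And>x. x \<in> X \<Longrightarrow> y * x \<in> closed_cspan Y" "x \<in> closed_cspan X"
  shows "y * x \<in> closed_cspan Y"
proof -
  note sub = closed_cspan_subspace[of Y]
  have "closed_cspan X \<subseteq> {x. y * x \<in> closed_cspan Y}"
  proof (rule closed_cspan_minimal)
    show "complex_vector.subspace {x. y * x \<in> closed_cspan Y}"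
      by (auto intro!: complex_vector.subspaceI
          simp: distrib_left scaleC_mult_right complex_vector.subspace_0[OF sub]
            complex_vector.subspace_add[OF sub] complex_vector.subspace_scale[OF sub])
    have "closed ((*) y -` closed_cspan Y)"
      by (intro closed_vimage closed_closed_cspan continuous_intros)
    then show "closed {x. y * x \<in> closed_cspan Y}" by (simp add: vimage_def)
  qed (use assms in auto)
  with assms show ?thesis by blast
qed

text \<open>Used to show that a closed subspace \<open>X\<close> is large: its multipliers form a
  closed subalgebra, contained in \<open>X\<close> as soon as \<open>1 \<in> X\<close>. It thus
  suffices to treat generators.\<close>

definition left_multipliers :: "'a :: unital_cstar_algebra set \<Rightarrow> 'a set" where
  "left_multipliers X = {y. \<forall>x\<in>X. y * x \<in> X}"

lemma left_multipliers_mult: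
  "x \<in> left_multipliers X \<Longrightarrow> y \<in> left_multipliers X \<Longrightarrow> x * y \<in> left_multipliers X"
  by (simp add: left_multipliers_def mult.assoc)

lemma left_multipliers_one: "1 \<in> left_multipliers X"
  by (simp add: left_multipliers_def)

lemma left_multipliers_subspace:
  assumes "complex_vector.subspace X"
  shows "complex_vector.subspace (left_multipliers X)"
  by (auto intro!: complex_vector.subspaceI
      simp: left_multipliers_def distrib_right scaleC_mult_left complex_vector.subspace_0[OF assms]
        complex_vector.subspace_add[OF assms] complex_vector.subspace_scale[OF assms])

lemma closed_left_multipliers:
  assumes "closed X"
  shows "closed (left_multipliers X)"
proof -
  have "left_multipliers X = (\<Inter>x\<in>X. (\<lambda>y. y * x) -` X)"
    by (auto simp: left_multipliers_def)
  also have "closed \<dots>"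
    by (intro closed_INT ballI closed_vimage assms continuous_intros)
  finally show ?thesis .
qed

lemma left_multipliers_prod_list:
  "set xs \<subseteq> left_multipliers X \<Longrightarrow> prod_list xs \<in> left_multipliers X"
  by (induction xs) (auto simp: left_multipliers_one left_multipliers_mult)

section \<open>Commuting Cuntz families and clopen projections\<close>

definition ordered_prod :: "(nat \<Rightarrow> 'a :: monoid_mult) \<Rightarrow> nat \<Rightarrow> 'a" where
  "ordered_prod f m = prod_list (map f [0..<m])"

lemma ordered_prod_0 [simp]: "ordered_prod f 0 = 1"
  by (simp add: ordered_prod_def)

lemma ordered_prod_Suc [simp]: "ordered_prod f (Suc m) = ordered_prod f m * f m"
  by (simp add: ordered_prod_def)

lemma ordered_prod_cong: "(\<And>i. i < m \<Longrightarrow> f i = g i) \<Longrightarrow> ordered_prod f m = ordered_prod g m"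
  by (induction m) auto

lemma ordered_prod_commute:
  "(\<And>i. i < m \<Longrightarrow> x * f i = f i * x) \<Longrightarrow> x * ordered_prod f m = ordered_prod f m * x"
proof (induction m)
  case (Suc m)
  then have "x * ordered_prod f m = ordered_prod f m * x" "x * f m = f m * x" by simp_all
  then show ?case by (metis ordered_prod_Suc mult.assoc)
qed simp

text \<open>In moving \<open>f m\<close> past \<open>ordered_prod g m\<close> only different indices
  meet; \<open>f i\<close> and \<open>g i\<close> keep their order and may fail to commute.\<close>

lemma ordered_prod_mult:
  assumes "\<And>i j. i < m \<Longrightarrow> j < m \<Longrightarrow> i \<noteq> j \<Longrightarrow> f i * g j = g j * f i"
  shows "ordered_prod f m * ordered_prod g m = ordered_prod (\<lambda>i. f i * g i) m"
  using assms
proof (induction m)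
  case (Suc m)
  have "f m * ordered_prod g m = ordered_prod g m * f m"
    by (rule ordered_prod_commute) (use Suc.prems in auto)
  then have "ordered_prod f m * f m * (ordered_prod g m * g m)
      = ordered_prod f m * ordered_prod g m * (f m * g m)"
    by (metis mult.assoc)
  then show ?case using Suc by simp
qed simp

lemma ordered_prod_one: "ordered_prod (\<lambda>_. 1) m = 1"
  by (induction m) auto

lemma ordered_prod_zero:
  "i < m \<Longrightarrow> f i = 0 \<Longrightarrow> ordered_prod f m = (0 :: 'a :: ring_1)"
  by (induction m) (auto simp: less_Suc_eq)

lemma ordered_prod_single:
  assumes "i < m"
  shows "ordered_prod (\<lambda>j. if j = i then x else 1) m = x"
  using assms
proof (induction m)
  case (Suc m)
  show ?case
  proof (cases "i = m")
    case True
    have "ordered_prod (\<lambda>j. if j = i then x else 1) m = ordered_prod (\<lambda>_. 1) m"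
      by (rule ordered_prod_cong) (use True in auto)
    then show ?thesis using True by (simp add: ordered_prod_one)
  qed (use Suc in auto)
qed simp

lemma ordered_prod_star:
  fixes f :: "nat \<Rightarrow> 'a :: unital_cstar_algebra"
  assumes "\<And>i j. i < m \<Longrightarrow> j < m \<Longrightarrow> i \<noteq> j \<Longrightarrow> f i * f j = f j * f i"
  shows "star (ordered_prod f m) = ordered_prod (\<lambda>i. star (f i)) m"
  using assms
proof (induction m)
  case (Suc m)
  have "star (f m) * ordered_prod (\<lambda>i. star (f i)) m = ordered_prod (\<lambda>i. star (f i)) m * star (f m)"
  proof (rule ordered_prod_commute)
    fix i assume "i < m"
    then have "f i * f m = f m * f i" using Suc.prems by simp
    then show "star (f m) * star (f i) = star (f i) * star (f m)" by (metis star_mult)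
  qed
  then show ?case using Suc by (simp add: star_mult)
qed (simp add: star_one)

lemma prod_list_commute:
  "(\<And>y. y \<in> set ys \<Longrightarrow> x * y = y * x) \<Longrightarrow> x * prod_list ys = prod_list ys * (x :: 'a :: monoid_mult)"
proof (induction ys)
  case (Cons y ys)
  then have "x * prod_list ys = prod_list ys * x" "x * y = y * x" by simp_all
  then show ?case by (metis mult.assoc prod_list.Cons)
qed simp

section \<open>Words in a single Cuntz family\<close>

lemma cuntz_family_isometry: "cuntz_family s \<Longrightarrow> star (s a) * s a = 1"
  by (cases a) (auto simp: cuntz_family_def)

text \<open>With \<open>x = star (s a) * s b\<close>, compressing the sum relation by
  \<open>s b\<close> gives \<open>1 = star x * x + 1\<close>.\<close>

lemma cuntz_family_orthogonal:
  assumes "cuntz_family s" "a \<noteq> b"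
  shows "star (s a) * s b = 0"
proof -
  have "s I1 * star (s I1) + s I2 * star (s I2) = 1"
    using assms by (simp add: cuntz_family_def)
  then have sum: "s a * star (s a) + s b * star (s b) = 1"
    using assms(2) by (cases a; cases b) (auto simp: add.commute)
  have "star (s b) * s b = star (s b) * (s a * star (s a) + s b * star (s b)) * s b"
    using sum by simp
  also have "\<dots> = star (s b) * s a * (star (s a) * s b) + (star (s b) * s b) * (star (s b) * s b)"
    by (simp add: algebra_simps)
  finally have "star (s b) * s a * (star (s a) * s b) = 0"
    using cuntz_family_isometry[OF assms(1), of b] by simp
  then have "norm (star (star (s a) * s b) * (star (s a) * s b)) = 0"
    by (simp add: star_mult star_star)
  then show ?thesis by (simp add: cstar_identity)
qed

lemma cuntz_word_Nil [simp]: "cuntz_word s [] = 1"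
  and cuntz_word_Cons [simp]: "cuntz_word s (a # w) = s a * cuntz_word s w"
  and cuntz_word_append: "cuntz_word s (v @ w) = cuntz_word s v * cuntz_word s w"
  by (simp_all add: cuntz_word_def)

lemma cuntz_word_isometry: "cuntz_family s \<Longrightarrow> star (cuntz_word s w) * cuntz_word s w = 1"
proof (induction w)
  case (Cons a w)
  have "star (cuntz_word s w) * star (s a) * (s a * cuntz_word s w)
      = star (cuntz_word s w) * (star (s a) * s a) * cuntz_word s w" by (simp add: mult.assoc)
  then show ?case using Cons by (simp add: star_mult cuntz_family_isometry)
qed (simp add: star_one)

lemma cuntz_word_orthogonal:
  assumes "cuntz_family s" "length v \<le> length w" "take (length v) w \<noteq> v"
  shows "star (cuntz_word s v) * cuntz_word s w = 0"
  using assms(2,3)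
proof (induction v arbitrary: w)
  case (Cons a v)
  then obtain b w' where w: "w = b # w'" by (cases w) auto
  have *: "star (cuntz_word s (a # v)) * cuntz_word s w
      = star (cuntz_word s v) * (star (s a) * s b) * cuntz_word s w'"
    by (simp add: w star_mult mult.assoc)
  show ?case
  proof (cases "a = b")
    case True
    with Cons.IH[of w'] Cons.prems show ?thesis
      unfolding * by (simp add: w cuntz_family_isometry[OF assms(1)])
  next
    case False
    then show ?thesis unfolding * by (simp add: cuntz_family_orthogonal[OF assms(1)])
  qed
qed simp

section \<open>Multiwords and cylinder projections\<close>

type_synonym multiword = "nat \<Rightarrow> cuntz_index list"

definition mappend :: "multiword \<Rightarrow> multiword \<Rightarrow> multiword" (infixr "\<diamond>" 75) where
  "(\<nu> \<diamond> \<eta>) i = \<nu> i @ \<eta> i"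

lemma mappend_assoc: "(\<mu> \<diamond> \<nu>) \<diamond> \<eta> = \<mu> \<diamond> \<nu> \<diamond> \<eta>"
  by (simp add: fun_eq_iff mappend_def)

abbreviation letter_at :: "nat \<Rightarrow> cuntz_index \<Rightarrow> multiword" where
  "letter_at i a \<equiv> (\<lambda>_. [])(i := [a])"

locale commuting_cuntz_families =
  fixes m :: nat and T :: "nat \<Rightarrow> cuntz_index \<Rightarrow> 'a :: unital_cstar_algebra"
  assumes family: "i < m \<Longrightarrow> cuntz_family (T i)"
    and comm: "i < m \<Longrightarrow> j < m \<Longrightarrow> i \<noteq> j \<Longrightarrow> T i a * T j b = T j b * T i a"
    and comm_star: "i < m \<Longrightarrow> j < m \<Longrightarrow> i \<noteq> j \<Longrightarrow> star (T i a) * T j b = T j b * star (T i a)"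
begin

definition S :: "multiword \<Rightarrow> 'a" where
  "S \<nu> = ordered_prod (\<lambda>i. cuntz_word (T i) (\<nu> i)) m"

definition P :: "multiword \<Rightarrow> 'a" where
  "P \<nu> = S \<nu> * star (S \<nu>)"

definition diagonal :: "'a set" where
  "diagonal = closed_cspan (range P)"

definition covers :: "multiword \<Rightarrow> multiword \<Rightarrow> bool" where
  "covers \<nu> \<mu> \<longleftrightarrow> (\<forall>i<m. take (length (\<nu> i)) (\<mu> i) = \<nu> i)"

definition long :: "nat \<Rightarrow> multiword \<Rightarrow> bool" where
  "long L \<nu> \<longleftrightarrow> (\<forall>i<m. L \<le> length (\<nu> i))"

text \<open>On every cylinder of some depth \<open>q\<close> acts as 0 or 1: this describes
  indicator functions of clopen sets in the product of \<open>m\<close> Cantor spaces. That such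
  \<open>q\<close> are projections in the diagonal is derived below.\<close>

definition clopen :: "'a \<Rightarrow> bool" where
  "clopen q \<longleftrightarrow> (\<exists>L. \<forall>\<nu>. long L \<nu> \<longrightarrow> q * S \<nu> = 0 \<or> q * S \<nu> = S \<nu>)"

lemma word_comm:
  assumes "i < m" "j < m" "i \<noteq> j"
  shows "cuntz_word (T i) v * cuntz_word (T j) w = cuntz_word (T j) w * cuntz_word (T i) v"
proof -
  have "T i a * cuntz_word (T j) w = cuntz_word (T j) w * T i a" for a
    unfolding cuntz_word_def by (rule prod_list_commute) (use comm assms in auto)
  then show ?thesis
    unfolding cuntz_word_def[of "T i"]
    by (intro prod_list_commute[symmetric]) auto
qed

lemma word_comm_star:
  assumes "i < m" "j < m" "i \<noteq> j"
  shows "star (cuntz_word (T i) v) * cuntz_word (T j) w = cuntz_word (T j) w * star (cuntz_word (T i) v)"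
proof -
  have "star (T i a) * cuntz_word (T j) w = cuntz_word (T j) w * star (T i a)" for a
    unfolding cuntz_word_def by (rule prod_list_commute) (use comm_star assms in auto)
  then have "star (cuntz_word (T j) w) * T i a = T i a * star (cuntz_word (T j) w)" for a
    by (metis star_mult star_star)
  then have "star (cuntz_word (T j) w) * cuntz_word (T i) v = cuntz_word (T i) v * star (cuntz_word (T j) w)"
    unfolding cuntz_word_def[of "T i"] by (intro prod_list_commute) auto
  then show ?thesis by (metis star_mult star_star)
qed

text \<open>Multiwords are functions on all of \<open>nat\<close>, but only coordinates below
  \<open>m\<close> enter \<open>S\<close>; equality of multiwords is therefore weakened to agreement
  there.\<close>

lemma S_cong: "(\<And>i. i < m \<Longrightarrow> \<mu> i = \<nu> i) \<Longrightarrow> S \<mu> = S \<nu>"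
  unfolding S_def by (rule ordered_prod_cong) auto

lemma P_cong: "(\<And>i. i < m \<Longrightarrow> \<mu> i = \<nu> i) \<Longrightarrow> P \<mu> = P \<nu>"
  unfolding P_def by (drule S_cong[of \<mu> \<nu>]) simp_all

lemma S_mappend: "S (\<nu> \<diamond> \<eta>) = S \<nu> * S \<eta>"
  unfolding S_def mappend_def cuntz_word_append
  by (rule ordered_prod_mult[symmetric]) (use word_comm in auto)

lemma star_S: "star (S \<nu>) = ordered_prod (\<lambda>i. star (cuntz_word (T i) (\<nu> i))) m"
  unfolding S_def by (rule ordered_prod_star) (use word_comm in auto)

lemma star_S_mult_S:
  "star (S \<mu>) * S \<nu> = ordered_prod (\<lambda>i. star (cuntz_word (T i) (\<mu> i)) * cuntz_word (T i) (\<nu> i)) m"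
  unfolding star_S unfolding S_def
  by (rule ordered_prod_mult) (use word_comm_star in auto)

lemma S_isometry [simp]: "star (S \<nu>) * S \<nu> = 1"
proof -
  have "star (S \<nu>) * S \<nu> = ordered_prod (\<lambda>_. 1) m"
    unfolding star_S_mult_S
    by (rule ordered_prod_cong) (simp add: cuntz_word_isometry family)
  then show ?thesis by (simp add: ordered_prod_one)
qed

lemma S_isometry2 [simp]: "star (S \<nu>) * (S \<nu> * x) = x"
  by (metis S_isometry mult.assoc mult_1)

lemma norm_S_mult [simp]: "norm (S \<nu> * x) = norm x"
  by (simp add: norm_isometry_mult)

lemma norm_S [simp]: "norm (S \<nu>) = 1"
  using norm_S_mult[of \<nu> 1] by simp

lemma norm_mult_star_S [simp]: "norm (x * star (S \<nu>)) = norm x"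
  using norm_S_mult[of \<nu> "star x"] norm_star by (metis star_mult star_star)

lemma S_nonzero [simp]: "S \<nu> \<noteq> 0"
  using norm_S[of \<nu>] by (metis norm_zero zero_neq_one)

lemma S_Nil [simp]: "S (\<lambda>_. []) = 1"
  by (simp add: S_def ordered_prod_one)

lemma S_orthogonal:
  assumes "i < m" "length (\<mu> i) \<le> length (\<nu> i)" "take (length (\<mu> i)) (\<nu> i) \<noteq> \<mu> i"
  shows "star (S \<mu>) * S \<nu> = 0"
  unfolding star_S_mult_S
  by (rule ordered_prod_zero[OF assms(1)]) (use assms cuntz_word_orthogonal family in blast)

lemma coversD:
  assumes "covers \<nu> \<mu>"
  obtains \<eta> where "\<And>i. i < m \<Longrightarrow> \<mu> i = (\<nu> \<diamond> \<eta>) i"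
proof (rule that[of "\<lambda>i. drop (length (\<nu> i)) (\<mu> i)"])
  fix i assume "i < m"
  with assms show "\<mu> i = (\<nu> \<diamond> (\<lambda>i. drop (length (\<nu> i)) (\<mu> i))) i"
    unfolding covers_def mappend_def by (metis append_take_drop_id)
qed

text \<open>The length hypothesis excludes that \<open>\<kappa>\<close> properly extends
  \<open>\<nu>\<close> in some coordinate, the case in which an adjoint letter would
  survive.\<close>

lemma star_S_mult_S_cases:
  assumes "\<And>i. i < m \<Longrightarrow> length (\<kappa> i) \<le> length (\<nu> i)"
  shows "star (S \<kappa>) * S \<nu> \<in> insert 0 (range S)"
proof (cases "covers \<kappa> \<nu>")
  case True
  then obtain \<eta> where "\<And>i. i < m \<Longrightarrow> \<nu> i = (\<kappa> \<diamond> \<eta>) i" using coversD by blast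
  then have "S \<nu> = S (\<kappa> \<diamond> \<eta>)" by (rule S_cong)
  then show ?thesis by (simp add: S_mappend)
next
  case False
  then show ?thesis using assms S_orthogonal unfolding covers_def by blast
qed

lemma covers_mappend: "covers \<nu> (\<nu> \<diamond> \<eta>)"
  by (simp add: covers_def mappend_def)

lemma P_S_covers: "covers \<kappa> \<mu> \<Longrightarrow> P \<kappa> * S \<mu> = S \<mu>"
  by (erule coversD) (simp add: S_cong[of \<mu>] S_mappend P_def mult.assoc)

lemma P_S:
  assumes "\<And>i. i < m \<Longrightarrow> length (\<kappa> i) \<le> length (\<mu> i)"
  shows "P \<kappa> * S \<mu> = (if covers \<kappa> \<mu> then S \<mu> else 0)"
proof (cases "covers \<kappa> \<mu>")
  case False
  then have "star (S \<kappa>) * S \<mu> = 0"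
    using S_orthogonal assms unfolding covers_def by blast
  with False show ?thesis by (simp add: P_def mult.assoc)
qed (simp add: P_S_covers)

lemma P_selfadjoint [simp]: "star (P \<nu>) = P \<nu>"
  by (simp add: P_def star_mult star_star)

lemma P_idem [simp]: "P \<nu> * P \<nu> = P \<nu>"
  by (simp add: P_def mult.assoc)

lemma P_nonzero [simp]: "P \<nu> \<noteq> 0"
  using norm_mult_star_S[of "S \<nu>" \<nu>] by (metis P_def norm_S norm_zero zero_neq_one)

lemma P_Nil [simp]: "P (\<lambda>_. []) = 1"
  by (simp add: P_def star_one)

lemma P_mappend: "P (\<nu> \<diamond> \<eta>) = S \<nu> * P \<eta> * star (S \<nu>)"
  by (simp add: P_def S_mappend star_mult mult.assoc)

lemma P_mult_P_mappend: "P \<nu> * P (\<nu> \<diamond> \<eta>) = P (\<nu> \<diamond> \<eta>)"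
  using P_S_covers[OF covers_mappend[of \<nu> \<eta>]] by (metis P_def mult.assoc)

lemma S_single:
  assumes "i < m"
  shows "S ((\<lambda>_. [])(i := w)) = cuntz_word (T i) w"
proof -
  have "S ((\<lambda>_. [])(i := w)) = ordered_prod (\<lambda>j. if j = i then cuntz_word (T i) w else 1) m"
    unfolding S_def by (intro ordered_prod_cong) auto
  then show ?thesis using assms by (simp add: ordered_prod_single)
qed

lemma S_letter_at: "i < m \<Longrightarrow> S (letter_at i a) = T i a"
  by (simp only: S_single) simp

lemma P_split:
  assumes "i < m"
  shows "P \<nu> = P (\<nu> \<diamond> letter_at i I1) + P (\<nu> \<diamond> letter_at i I2)"
proof -
  have "P (letter_at i I1) + P (letter_at i I2) = 1"
    using family[OF assms] by (simp add: P_def S_letter_at[OF assms] cuntz_family_def del: fun_upd_apply)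
  then have "S \<nu> * (P (letter_at i I1) + P (letter_at i I2)) * star (S \<nu>) = P \<nu>"
    by (simp add: P_def)
  then show ?thesis by (simp add: P_mappend distrib_left distrib_right)
qed

text \<open>Every additive property of long cylinders passes to 1, since each cylinder is the sum of
  its two halves in any coordinate. The induction is on the total number of missing letters.\<close>

lemma split_induct:
  assumes add: "\<And>x y. x \<in> X \<Longrightarrow> y \<in> X \<Longrightarrow> x + y \<in> X"
    and P: "\<And>\<nu>. long L \<nu> \<Longrightarrow> P \<nu> \<in> X"
  shows "1 \<in> X"
proof -
  have "P \<nu> \<in> X" if "(\<Sum>i<m. L - length (\<nu> i)) = k" for \<nu> k
    using that
  proof (induction k arbitrary: \<nu> rule: less_induct)
    case (less k)
    show ?case
    proof (cases "long L \<nu>")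
      case False
      then obtain i where i: "i < m" "length (\<nu> i) < L" by (auto simp: long_def not_le)
      have "P (\<nu> \<diamond> letter_at i a) \<in> X" for a
      proof (rule less.IH[OF _ refl])
        have "(\<Sum>j<m. L - length ((\<nu> \<diamond> letter_at i a) j)) < (\<Sum>j<m. L - length (\<nu> j))"
          by (rule sum_strict_mono_strong[of _ i]) (use i in \<open>auto simp: mappend_def\<close>)
        then show "(\<Sum>j<m. L - length ((\<nu> \<diamond> letter_at i a) j)) < k" using less.prems by simp
      qed
      then show ?thesis using P_split[OF i(1), of \<nu>] add by simp
    qed (rule P)
  qed
  from this[OF refl, of "\<lambda>_. []"] show ?thesis by simp
qed

lemma eq_if_eq_on_long:
  assumes "\<And>\<nu>. long L \<nu> \<Longrightarrow> x * S \<nu> = y * S \<nu>"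
  shows "x = y"
proof -
  have "1 \<in> {z. x * z = y * z}"
    by (rule split_induct[of _ L]) (use assms in \<open>auto simp: distrib_left P_def mult.assoc[symmetric]\<close>)
  then show ?thesis by simp
qed

section \<open>The Boolean algebra of clopen projections\<close>

lemma long_mono: "long L \<nu> \<Longrightarrow> K \<le> L \<Longrightarrow> long K \<nu>"
  by (auto simp: long_def intro: order_trans)

lemma clopen_P: "clopen (P \<kappa>)"
  unfolding clopen_def
proof (intro exI allI impI)
  \<comment> \<open>The sum bounds the lengths in all coordinates at once and makes sense for
    \<open>m = 0\<close> too.\<close>
  fix \<nu> assume "long (\<Sum>i<m. length (\<kappa> i)) \<nu>"
  then have "length (\<kappa> i) \<le> length (\<nu> i)" if "i < m" for i
    using that member_le_sum[of i "{..<m}" "\<lambda>i. length (\<kappa> i)"] by (force simp: long_def)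
  then show "P \<kappa> * S \<nu> = 0 \<or> P \<kappa> * S \<nu> = S \<nu>" by (simp add: P_S)
qed

lemma clopen_0: "clopen 0"
  by (auto simp: clopen_def)

lemma clopen_mult:
  assumes "clopen q" "clopen r"
  shows "clopen (q * r)" "q * r = r * q"
proof -
  obtain K L where K: "\<And>\<nu>. long K \<nu> \<Longrightarrow> q * S \<nu> = 0 \<or> q * S \<nu> = S \<nu>"
    and L: "\<And>\<nu>. long L \<nu> \<Longrightarrow> r * S \<nu> = 0 \<or> r * S \<nu> = S \<nu>"
    using assms by (auto simp: clopen_def)
  have *: "q * r * S \<nu> = r * q * S \<nu> \<and> (q * r * S \<nu> = 0 \<or> q * r * S \<nu> = S \<nu>)" if "long (max K L) \<nu>" for \<nu>
  proof -
    have "long K \<nu>" "long L \<nu>" using that long_mono by force+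
    with K[of \<nu>] L[of \<nu>] show ?thesis by (auto simp: mult.assoc)
  qed
  show "clopen (q * r)" unfolding clopen_def using * by blast
  show "q * r = r * q" by (rule eq_if_eq_on_long) (use * in blast)
qed

lemma clopen_complement:
  assumes "clopen q"
  shows "clopen (1 - q)"
proof -
  obtain L where L: "\<And>\<nu>. long L \<nu> \<Longrightarrow> q * S \<nu> = 0 \<or> q * S \<nu> = S \<nu>"
    using assms by (auto simp: clopen_def)
  have "(1 - q) * S \<nu> = 0 \<or> (1 - q) * S \<nu> = S \<nu>" if "long L \<nu>" for \<nu>
    using L[OF that] by (auto simp: left_diff_distrib)
  then show ?thesis by (auto simp: clopen_def)
qed

lemma clopen_1: "clopen 1"
  using clopen_complement[OF clopen_0] by simp

text \<open>Both identities can be tested on long words. For the adjoint, \<open>q * P \<nu>\<close>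
  is \<open>0\<close> or \<open>P \<nu>\<close>, hence self-adjoint, and \<open>q\<close> commutes
  with \<open>P \<nu>\<close>.\<close>

lemma clopen_projection:
  assumes "clopen q"
  shows "q * q = q" "star q = q"
proof -
  obtain L where L: "\<And>\<nu>. long L \<nu> \<Longrightarrow> q * S \<nu> = 0 \<or> q * S \<nu> = S \<nu>"
    using assms by (auto simp: clopen_def)
  show "q * q = q"
    by (rule eq_if_eq_on_long[of L]) (use L in \<open>metis mult.assoc mult_zero_right\<close>)
  show "star q = q"
  proof (rule eq_if_eq_on_long[of L])
    fix \<nu> assume "long L \<nu>"
    then have "q * P \<nu> = 0 \<or> q * P \<nu> = P \<nu>"
      using L unfolding P_def by (metis mult.assoc mult_zero_left)
    moreover have "q * P \<nu> = P \<nu> * q" using clopen_mult(2)[OF assms clopen_P] .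
    then have "star q * P \<nu> = star (q * P \<nu>)"
      by (metis P_selfadjoint star_mult)
    ultimately have "star q * P \<nu> = q * P \<nu>" by (auto simp: star_zero)
    then have "star q * P \<nu> * S \<nu> = q * P \<nu> * S \<nu>" by simp
    then show "star q * S \<nu> = q * S \<nu>"
      using P_S_covers[of \<nu> \<nu>] by (simp add: covers_def mult.assoc)
  qed
qed

lemma clopen_nonzero:
  assumes "clopen q" "q \<noteq> 0"
  obtains \<nu> where "long L \<nu>" "q * S \<nu> = S \<nu>"
proof -
  obtain K where K: "\<And>\<nu>. long K \<nu> \<Longrightarrow> q * S \<nu> = 0 \<or> q * S \<nu> = S \<nu>"
    using assms by (auto simp: clopen_def)
  obtain \<nu> where "long (max K L) \<nu>" "q * S \<nu> \<noteq> 0"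
    using eq_if_eq_on_long[of "max K L" q 0] assms by auto
  with K[of \<nu>] that[of \<nu>] show ?thesis using long_mono by force
qed

text \<open>Words at least as long as \<open>\<alpha>\<close> in every coordinate either extend
  \<open>\<alpha>\<close> or are annihilated by \<open>P \<alpha>\<close>; so a nonempty clopen part
  of a cylinder contains a subcylinder.\<close>

lemma clopen_nonzero_below:
  assumes "clopen q" "q \<noteq> 0" "q * P \<alpha> = q"
  obtains \<eta> where "q * S (\<alpha> \<diamond> \<eta>) = S (\<alpha> \<diamond> \<eta>)"
proof -
  obtain \<nu> where \<nu>: "long (\<Sum>i<m. length (\<alpha> i)) \<nu>" "q * S \<nu> = S \<nu>"
    using clopen_nonzero[OF assms(1,2)] .
  have "length (\<alpha> i) \<le> length (\<nu> i)" if "i < m" for i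
    using that member_le_sum[of i "{..<m}" "\<lambda>i. length (\<alpha> i)"] \<nu>(1) by (force simp: long_def)
  moreover have "P \<alpha> * S \<nu> \<noteq> 0"
    using assms(3) \<nu>(2) by (metis S_nonzero mult.assoc mult_zero_right)
  ultimately have "covers \<alpha> \<nu>" using P_S[of \<alpha> \<nu>] by (auto split: if_splits)
  then obtain \<eta> where "\<And>i. i < m \<Longrightarrow> \<nu> i = (\<alpha> \<diamond> \<eta>) i" using coversD by blast
  then have "S \<nu> = S (\<alpha> \<diamond> \<eta>)" by (rule S_cong)
  with \<nu>(2) that show ?thesis by simp
qed

lemma clopen_in_diagonal:
  assumes "clopen q"
  shows "q \<in> diagonal"
proof -
  note sub = closed_cspan_subspace[of "range P"]
  obtain L where L: "\<And>\<nu>. long L \<nu> \<Longrightarrow> q * S \<nu> = 0 \<or> q * S \<nu> = S \<nu>"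
    using assms by (auto simp: clopen_def)
  have "1 \<in> {x. q * x \<in> diagonal}"
  proof (rule split_induct[of _ L])
    fix \<nu> assume "long L \<nu>"
    then have "q * P \<nu> = 0 \<or> q * P \<nu> = P \<nu>"
      using L unfolding P_def by (metis mult.assoc mult_zero_left)
    then show "P \<nu> \<in> {x. q * x \<in> diagonal}"
      using complex_vector.subspace_0[OF sub] closed_cspan_base[of "P \<nu>" "range P"]
      by (auto simp: diagonal_def)
  qed (use complex_vector.subspace_add[OF sub] in \<open>auto simp: distrib_left diagonal_def\<close>)
  then show ?thesis by simp
qed

section \<open>Projections of the diagonal are clopen\<close>

lemma diagonal_commute:
  assumes "d \<in> diagonal"
  shows "d * P \<nu> = P \<nu> * d"
proof -
  have "diagonal \<subseteq> {d. d * P \<nu> = P \<nu> * d}"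
    unfolding diagonal_def
  proof (rule closed_cspan_minimal)
    show "range P \<subseteq> {d. d * P \<nu> = P \<nu> * d}"
      using clopen_mult(2)[OF clopen_P clopen_P] by blast
    show "complex_vector.subspace {d. d * P \<nu> = P \<nu> * d}"
      by (rule complex_vector.subspaceI)
        (auto simp: distrib_left distrib_right scaleC_mult_left scaleC_mult_right)
    show "closed {d. d * P \<nu> = P \<nu> * d}"
      by (intro closed_Collect_eq continuous_intros)
  qed
  with assms show ?thesis by blast
qed

lemma cspan_P_scalar:
  assumes "d \<in> cspan (range P)"
  shows "\<exists>L. \<forall>\<nu>. long L \<nu> \<longrightarrow> (\<exists>c. d * S \<nu> = c *\<^sub>C S \<nu>)"
  using assms
proof (induction rule: complex_vector.span_induct_alt)
  case base
  show ?case by (auto intro!: exI[of _ 0])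
next
  case (step c x y)
  then obtain L where L: "\<And>\<nu>. long L \<nu> \<Longrightarrow> \<exists>c. y * S \<nu> = c *\<^sub>C S \<nu>" by blast
  from step obtain \<kappa> where x: "x = P \<kappa>" by blast
  obtain K where K: "\<And>\<nu>. long K \<nu> \<Longrightarrow> x * S \<nu> = 0 \<or> x * S \<nu> = S \<nu>"
    using clopen_P[of \<kappa>] by (auto simp: clopen_def x)
  show ?case
  proof (rule exI[of _ "max K L"], intro allI impI)
    fix \<nu> assume "long (max K L) \<nu>"
    then have "long K \<nu>" "long L \<nu>" using long_mono by force+
    with K L obtain d where d: "y * S \<nu> = d *\<^sub>C S \<nu>" and "x * S \<nu> = 0 \<or> x * S \<nu> = S \<nu>" by blast
    then show "\<exists>e. (c *\<^sub>C x + y) * S \<nu> = e *\<^sub>C S \<nu>"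
    proof (elim disjE)
      assume "x * S \<nu> = S \<nu>"
      then show ?thesis
        by (intro exI[of _ "c + d"]) (simp add: distrib_right scaleC_mult_left d scaleC_add_left)
    qed (auto intro!: exI[of _ d] simp: distrib_right scaleC_mult_left d)
  qed
qed

text \<open>Some \<open>d\<close> with \<open>norm (q - d) < 1/2\<close> is a scalar
  \<open>c\<close> on each long cylinder. If \<open>q\<close> cut a cylinder into two nonzero
  pieces, \<open>c\<close> would have distance less than \<open>1/2\<close> from both 1 and
  0.\<close>

lemma diagonal_projection_clopen:
  assumes "q \<in> diagonal" "q * q = q" "star q = q"
  shows "clopen q"
proof -
  obtain d where d: "d \<in> cspan (range P)" "norm (q - d) < 1/2"
    using assms(1) unfolding diagonal_def closed_cspan_def
    by (auto simp: closure_approachable dist_norm norm_minus_commute dest: spec[of _ "1/2"])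
  obtain L where L: "\<And>\<nu>. long L \<nu> \<Longrightarrow> \<exists>c. d * S \<nu> = c *\<^sub>C S \<nu>"
    using cspan_P_scalar[OF d(1)] by blast
  have "q * S \<nu> = 0 \<or> q * S \<nu> = S \<nu>" if long: "long L \<nu>" for \<nu>
  proof (rule ccontr)
    assume neg: "\<not> ?thesis"
    obtain c where c: "d * S \<nu> = c *\<^sub>C S \<nu>" using L[OF long] by blast
    have cP: "d * P \<nu> = c *\<^sub>C P \<nu>" unfolding P_def using c by (metis mult.assoc scaleC_mult_left)
    have comm: "q * P \<nu> = P \<nu> * q" by (rule diagonal_commute[OF assms(1)])
    have near: "norm (q * e - c *\<^sub>C e) < 1/2"
      if "e * e = e" "star e = e" "P \<nu> * e = e" for e
    proof -
      have "d * e = c *\<^sub>C e" using cP that by (metis mult.assoc scaleC_mult_left)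
      then have "q * e - c *\<^sub>C e = (q - d) * e"
        by (simp add: left_diff_distrib)
      then show ?thesis using norm_projection_mult_le(2)[of e "q - d"] that d(2) by simp
    qed
    define e where "e = q * P \<nu>"
    define f where "f = (1 - q) * P \<nu>"
    have ff: "(1 - q) * (1 - q) = 1 - q" using assms(2) by (simp add: algebra_simps)
    have fc: "(1 - q) * P \<nu> = P \<nu> * (1 - q)" using comm by (simp add: algebra_simps)
    have e: "e * e = e" "star e = e" "P \<nu> * e = e" "q * e = e"
    proof -
      show "q * e = e" using assms by (simp add: e_def mult.assoc[symmetric])
      show Pe: "P \<nu> * e = e" by (metis comm e_def P_idem mult.assoc)
      show "e * e = e" using Pe \<open>q * e = e\<close> by (metis e_def mult.assoc)
      show "star e = e" using comm assms by (simp add: e_def star_mult)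
    qed
    have f: "f * f = f" "star f = f" "P \<nu> * f = f" "q * f = 0"
    proof -
      show "q * f = 0" using assms by (simp add: f_def algebra_simps mult.assoc[symmetric])
      show Pf: "P \<nu> * f = f" by (metis fc f_def P_idem mult.assoc)
      have "(1 - q) * f = f" using ff by (simp add: f_def mult.assoc[symmetric])
      then show "f * f = f" using Pf by (metis f_def mult.assoc)
      show "star f = f" using fc assms by (simp add: f_def star_mult star_diff star_one)
    qed
    have "P \<nu> * S \<nu> = S \<nu>" using P_S_covers[of \<nu> \<nu>] by (simp add: covers_def)
    then have eS: "e * S \<nu> = q * S \<nu>" "f * S \<nu> = (1 - q) * S \<nu>" by (simp_all add: e_def f_def mult.assoc)
    have "e \<noteq> 0" "f \<noteq> 0" using neg eS by (auto simp: left_diff_distrib)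
    have "norm ((1 - c) *\<^sub>C e) < 1/2"
      using near[of e] e
      by (simp add: complex_vector.scale_left_diff_distrib)
    moreover have "norm (c *\<^sub>C f) < 1/2"
      using near[of f] f by simp
    ultimately have "cmod (1 - c) + cmod c < 1"
      using norm_projection[of e] norm_projection[of f] e f \<open>e \<noteq> 0\<close> \<open>f \<noteq> 0\<close> by (simp add: norm_scaleC)
    then show False using norm_triangle_ineq[of "1 - c" c] by simp
  qed
  then show ?thesis by (auto simp: clopen_def)
qed

text \<open>The right-hand side mentions only the diagonal and the *-algebra structure, so
  isomorphisms carrying diagonal onto diagonal preserve clopen projections.\<close>

lemma clopen_iff_diagonal_projection:
  "clopen q \<longleftrightarrow> q \<in> diagonal \<and> q * q = q \<and> star q = q"
  using clopen_in_diagonal clopen_projection diagonal_projection_clopen by blast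

end

section \<open>Normalizing unitaries act locally by prefix replacement\<close>

text \<open>For different lengths, the final \<open>I2\<close> of the first word lies over a letter
  \<open>I1\<close> of the second word's block, because the blocks are offset by
  \<open>length v - length u\<close>, which is between 1 and \<open>K\<close>. The separation works
  for every \<open>h\<close>, even if \<open>u\<close> is a prefix of \<open>v\<close>.\<close>

lemma take_append_marker_neq:
  assumes "length u \<le> length v" "length v \<le> K" "u \<noteq> v"
  shows "take (length (u @ h @ replicate K I1 @ [I2])) (v @ h @ replicate K I1 @ [I2])
    \<noteq> u @ h @ replicate K I1 @ [I2]"
proof
  define t where "t = replicate K I1 @ [I2]"
  assume "take (length (u @ h @ replicate K I1 @ [I2])) (v @ h @ replicate K I1 @ [I2])
    = u @ h @ replicate K I1 @ [I2]"
  then have eq: "take (length (u @ h @ t)) (v @ h @ t) = u @ h @ t" by (simp only: t_def)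
  show False
  proof (cases "length u = length v")
    case True
    with eq have "v @ h @ t = u @ h @ t" by simp
    with \<open>u \<noteq> v\<close> show False by simp
  next
    case False
    define k where "k = length v - length u"
    have k: "0 < k" "k \<le> K" "length v = length u + k" using assms False by (auto simp: k_def)
    \<comment> \<open>The position of the final \<open>I2\<close> in
      \<open>u @ h @ t\<close>.\<close>
    define j where "j = length u + length h + K"
    have "(u @ h @ t) ! j = I2"
      by (simp add: j_def t_def nth_append)
    moreover have "j = length (v @ h) + (K - k)" using k by (simp add: j_def)
    then have "(v @ h @ t) ! j = t ! (K - k)"
      by (simp only: append_assoc[symmetric] nth_append_length_plus)
    moreover have "t ! (K - k) = I1"
      using k by (simp add: t_def nth_append)
    moreover have "take (length (u @ h @ t)) (v @ h @ t) ! j = (v @ h @ t) ! j"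
      by (rule nth_take) (simp add: j_def t_def)
    ultimately show False using eq by simp
  qed
qed

context commuting_cuntz_families
begin

lemma S_marker_orthogonal:
  assumes "i < m" "u i \<noteq> v i" "length (u i) \<le> K" "length (v i) \<le> K"
    and "\<theta> = (\<lambda>_. replicate K I1 @ [I2])"
  shows "star (S (u \<diamond> \<eta> \<diamond> \<theta>)) * S (v \<diamond> \<eta> \<diamond> \<theta>) = 0"
proof -
  have le: "star (S (u \<diamond> \<eta> \<diamond> \<theta>)) * S (v \<diamond> \<eta> \<diamond> \<theta>) = 0"
    if "u i \<noteq> v i" "length (v i) \<le> K" "length (u i) \<le> length (v i)" for u v
    using take_append_marker_neq[OF that(3,2,1), of "\<eta> i"] that
    by (intro S_orthogonal[OF assms(1)]) (simp_all add: mappend_def assms(5))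
  show ?thesis
  proof (cases "length (u i) \<le> length (v i)")
    case False
    then have "star (S (v \<diamond> \<eta> \<diamond> \<theta>)) * S (u \<diamond> \<eta> \<diamond> \<theta>) = 0"
      using assms by (intro le) auto
    then show ?thesis by (metis star_mult star_star star_zero)
  qed (use le assms in blast)
qed

text \<open>Long words absorb adjoints: \<open>star (S \<kappa>) * S \<nu>\<close> is 0 or a word
  once \<open>\<nu>\<close> is at least as long as \<open>\<kappa>\<close> in every
  coordinate.\<close>

lemma cspan_S_S_star:
  assumes "a \<in> cspan (range (\<lambda>(\<mu>, \<kappa>). S \<mu> * star (S \<kappa>)))"
  shows "\<exists>L. \<forall>\<nu>. long L \<nu> \<longrightarrow> a * S \<nu> \<in> cspan (range S)"
  using assms
proof (induction rule: complex_vector.span_induct_alt)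
  case base
  show ?case by (simp add: complex_vector.span_zero)
next
  case (step c x y)
  then obtain L where L: "\<And>\<nu>. long L \<nu> \<Longrightarrow> y * S \<nu> \<in> cspan (range S)" by blast
  from step obtain \<mu> \<kappa> where x: "x = S \<mu> * star (S \<kappa>)" by auto
  define K where "K = (\<Sum>i<m. length (\<kappa> i))"
  show ?case
  proof (rule exI[of _ "max K L"], intro allI impI)
    fix \<nu> assume "long (max K L) \<nu>"
    then have \<nu>: "long K \<nu>" "long L \<nu>" using long_mono by force+
    have len: "length (\<kappa> i) \<le> length (\<nu> i)" if "i < m" for i
      using that member_le_sum[of i "{..<m}" "\<lambda>i. length (\<kappa> i)"] \<nu>(1)
      by (force simp: long_def K_def)
    have "x * S \<nu> \<in> cspan (range S)"
    proof -
      have "star (S \<kappa>) * S \<nu> = 0 \<or> (\<exists>\<eta>. star (S \<kappa>) * S \<nu> = S \<eta>)"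
        using star_S_mult_S_cases[of \<kappa> \<nu>] len by (meson imageE insertE)
      then show ?thesis
        by (auto simp: x mult.assoc S_mappend[symmetric] complex_vector.span_zero complex_vector.span_base)
    qed
    then show "(c *\<^sub>C x + y) * S \<nu> \<in> cspan (range S)"
      using L[OF \<nu>(2)]
      by (simp add: distrib_right scaleC_mult_left complex_vector.span_add complex_vector.span_scale)
  qed
qed

text \<open>Both directions of conjugation are used: images of cylinders are compared with
  cylinders, and remainders in the image are pulled back.\<close>

definition normalizing :: "'a \<Rightarrow> bool" where
  "normalizing V \<longleftrightarrow> star V * V = 1 \<and> V * star V = 1 \<and>
    (\<forall>q. clopen q \<longrightarrow> clopen (V * q * star V) \<and> clopen (star V * q * V))"

lemma clopen_norm_one: "clopen q \<Longrightarrow> q \<noteq> 0 \<Longrightarrow> norm q = 1"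
  using norm_projection clopen_projection by blast

text \<open>The estimate for \<open>V - a\<close> is compressed between clopen projections on which
  \<open>V\<close> and \<open>a\<close> are known exactly: \<open>V\<close> is isometric, and
  \<open>f u * a\<close> is \<open>c u\<close> times an isometry on \<open>P \<zeta>\<close>. A
  cylinder \<open>f u\<close> that meets \<open>r\<close> has a large coefficient, one not contained
  in \<open>r\<close> a small one. So those meeting \<open>r\<close> lie in it, and one of them is
  all of \<open>r\<close>.\<close>

lemma normalizing_dominant_coefficient:
  assumes V: "normalizing V"
    and near: "norm (V - a) < 1/2"
    and M: "finite M" "a * S \<zeta> = (\<Sum>u\<in>M. c u *\<^sub>C S (Y u))"
    and orth: "\<And>u v. u \<in> M \<Longrightarrow> v \<in> M \<Longrightarrow> u \<noteq> v \<Longrightarrow> star (S (Y u)) * S (Y v) = 0"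
  shows "\<exists>u\<in>M. V * P \<zeta> * star V = P (Y u) \<and> (\<forall>v\<in>M. 1/2 < cmod (c v) \<longleftrightarrow> v = u)"
proof -
  have VV [simp]: "star V * V = 1" "V * star V = 1" and Vc: "\<And>q. clopen q \<Longrightarrow> clopen (star V * q * V)"
    using V by (auto simp: normalizing_def)
  have [simp]: "star V * (V * x) = x" "V * (star V * x) = x" for x
    by (metis VV mult.assoc mult_1)+
  define q where "q = P \<zeta>"
  define r where "r = V * q * star V"
  define f where "f u = P (Y u)" for u
  have cl: "clopen q" "clopen r" "clopen (f u)" for u
    using V clopen_P by (auto simp: q_def r_def f_def normalizing_def)
  have rV: "r * V = V * q" by (simp add: r_def mult.assoc)
  have rr: "r * (r * x) = r * x" for x by (metis clopen_projection(1)[OF cl(2)] mult.assoc)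
  have compress: "norm (g * (V - a) * h) < 1/2" if "clopen g" "clopen h" for g h
    using norm_projection_mult_le(1)[of g "(V - a) * h"] norm_projection_mult_le(2)[of h "V - a"]
      clopen_projection that near by (simp add: mult.assoc)
  have fS: "f u * S (Y v) = (if u = v then S (Y u) else 0)" if "u \<in> M" "v \<in> M" for u v
    using orth[OF that] by (auto simp: f_def P_def mult.assoc)
  have aq: "a * q = (\<Sum>u\<in>M. c u *\<^sub>C (S (Y u) * star (S \<zeta>)))"
  proof -
    have "a * q = a * S \<zeta> * star (S \<zeta>)" by (simp add: q_def P_def mult.assoc)
    then show ?thesis by (simp add: M(2) sum_distrib_right scaleC_mult_left)
  qed
  have faq: "f u * a * q = c u *\<^sub>C (S (Y u) * star (S \<zeta>))" if "u \<in> M" for u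
  proof -
    have "f u * a * q = (\<Sum>v\<in>M. c v *\<^sub>C (f u * S (Y v) * star (S \<zeta>)))"
      by (simp add: mult.assoc aq sum_distrib_left scaleC_mult_right)
    also have "\<dots> = (\<Sum>v\<in>M. if v = u then c u *\<^sub>C (S (Y u) * star (S \<zeta>)) else 0)"
      by (rule sum.cong) (use that in \<open>auto simp: fS\<close>)
    finally show ?thesis using that M(1) by simp
  qed
  \<comment> \<open>A part \<open>g\<close> of \<open>r\<close> is pulled back to the part
    \<open>q'\<close> of \<open>q\<close> that \<open>V\<close> carries onto it; the norms of both
    terms on \<open>q'\<close> are then exact.\<close>
  have pull: "norm (V * q') = 1" "norm (f u * a * q') = cmod (c u)" "V * q' = g * V" "clopen q'"
    if "clopen g" "g \<noteq> 0" "r * g = g" "q' = star V * g * V" "u \<in> M" for g q' u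
  proof -
    show Vq: "V * q' = g * V" by (simp add: that(4) mult.assoc)
    show c': "clopen q'" using Vc that by simp
    have "V * q' * star V = g" by (simp add: that(4) mult.assoc)
    then have "q' \<noteq> 0" using that(2) by auto
    then have n: "norm q' = 1" using c' clopen_norm_one by blast
    then show "norm (V * q') = 1" by (simp add: norm_isometry_mult)
    have "q * q' = star V * (r * g) * V" by (simp add: r_def that(4) mult.assoc)
    then have qq: "q * q' = q'" using that(3,4) by simp
    have "norm (star (S \<zeta>) * q') = norm (S \<zeta> * (star (S \<zeta>) * q'))" by simp
    also have "\<dots> = 1" using qq n by (simp add: q_def P_def mult.assoc)
    finally have n2: "norm (star (S \<zeta>) * q') = 1" .
    have "f u * a * q' = c u *\<^sub>C (S (Y u) * (star (S \<zeta>) * q'))"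
      using faq[OF that(5)] qq by (metis mult.assoc scaleC_mult_left)
    then show "norm (f u * a * q') = cmod (c u)" using n2 by (simp add: norm_scaleC)
  qed
  \<comment> \<open>Compression to the common part of \<open>f u\<close> and \<open>r\<close>:
    \<open>V\<close> contributes norm 1 and \<open>a\<close> contributes
    \<open>cmod (c u)\<close>.\<close>
  have A: "1/2 < cmod (c u)" if u: "u \<in> M" "f u * r \<noteq> 0" for u
  proof -
    define g where "g = f u * r"
    define q' where "q' = star V * g * V"
    have g: "clopen g" "g \<noteq> 0" "r * g = g" "f u * g = g"
    proof -
      show "clopen g" "g \<noteq> 0" using clopen_mult(1)[OF cl(3)[of u] cl(2)] u by (simp_all add: g_def)
      show "r * g = g" using rr clopen_mult(2)[OF cl(3)[of u] cl(2)] clopen_projection(1)[OF cl(2)]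
        unfolding g_def by (metis mult.assoc)
      show "f u * g = g" using clopen_projection(1)[OF cl(3)[of u]] unfolding g_def by (metis mult.assoc)
    qed
    note p = pull[OF g(1-3) q'_def u(1)]
    have "f u * (V - a) * q' = V * q' - f u * a * q'"
      using p(3) g(4) by (simp add: algebra_simps) (metis mult.assoc)
    moreover have "norm (f u * (V - a) * q') < 1/2" using compress cl p(4) by blast
    ultimately have "norm (V * q' - f u * a * q') < 1/2" by simp
    then show ?thesis using p(1,2) norm_triangle_ineq2[of "V * q'" "f u * a * q'"] by linarith
  qed
  \<comment> \<open>Compression to the part of \<open>f u\<close> outside \<open>r\<close>:
    \<open>V\<close> contributes nothing, so the coefficient alone must be below
    \<open>1/2\<close>.\<close>
  have B: "cmod (c u) < 1/2" if u: "u \<in> M" "r * f u \<noteq> f u" for u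
  proof -
    define g where "g = (1 - r) * f u"
    have g: "clopen g" "g \<noteq> 0" "g = f u * (1 - r)" "g * f u = g"
    proof -
      show "clopen g" "g = f u * (1 - r)"
        using clopen_mult[OF clopen_complement[OF cl(2)] cl(3)[of u]] by (simp_all add: g_def)
      show "g \<noteq> 0" using u by (simp add: g_def algebra_simps)
      show "g * f u = g" using clopen_projection(1)[OF cl(3)[of u]] unfolding g_def by (metis mult.assoc)
    qed
    have "(1 - r) * (V * q) = 0"
      using clopen_projection(1)[OF cl(2)] by (simp add: rV[symmetric] algebra_simps mult.assoc[symmetric])
    then have "g * V * q = 0" by (simp add: g(3) mult.assoc)
    then have "g * (V - a) * q = - (g * a * q)" by (simp add: algebra_simps)
    moreover have "g * a * q = c u *\<^sub>C (g * S (Y u) * star (S \<zeta>))"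
      using faq[OF u(1)] g(4) by (metis mult.assoc scaleC_mult_right)
    moreover have "norm (g * S (Y u)) = norm (g * f u)"
      using norm_mult_star_S[of "g * S (Y u)" "Y u"] by (simp add: f_def P_def mult.assoc)
    then have "norm (g * S (Y u) * star (S \<zeta>)) = 1"
      using g clopen_norm_one by (simp add: g(4))
    ultimately show ?thesis using compress[OF g(1) cl(1)] by (simp add: norm_scaleC)
  qed
  \<comment> \<open>If all \<open>f u\<close> missed \<open>r\<close>, then
    \<open>r * (a * q)\<close> would vanish, while \<open>V * q\<close> has norm 1.\<close>
  have "\<exists>u\<in>M. f u * r \<noteq> 0"
  proof (rule ccontr)
    assume "\<not> ?thesis"
    then have z: "r * f u = 0" if "u \<in> M" for u using that clopen_mult(2)[OF cl(2) cl(3)[of u]] by simp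
    have "r * S (Y u) = 0" if "u \<in> M" for u
      using z[OF that] fS[OF that that] by (metis mult.assoc mult_zero_left)
    then have "r * (a * q) = 0"
      unfolding aq sum_distrib_left by (intro sum.neutral) (simp add: scaleC_mult_right mult.assoc[symmetric])
    moreover have "r * (V * q) = V * q"
      using clopen_projection(1)[OF cl(2)] by (simp add: rV[symmetric] mult.assoc[symmetric])
    ultimately have "r * (V - a) * q = V * q" by (simp add: algebra_simps)
    moreover have "norm (V * q) = 1"
      using clopen_norm_one[OF cl(1)] by (simp add: norm_isometry_mult q_def)
    ultimately show False using compress[OF cl(2,1)] by simp
  qed
  then obtain u where u: "u \<in> M" "f u * r \<noteq> 0" by blast
  have cu: "1/2 < cmod (c u)" using A u by blast
  then have rf: "r * f u = f u" using B[OF u(1)] by force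
  \<comment> \<open>On a part of \<open>r\<close> outside \<open>f u\<close>, compression by
    \<open>f u\<close> would kill \<open>V\<close> and leave a term of norm
    \<open>cmod (c u) > 1/2\<close>.\<close>
  have r: "r = f u"
  proof (rule ccontr)
    assume ne: "r \<noteq> f u"
    define g where "g = r * (1 - f u)"
    define q' where "q' = star V * g * V"
    have g: "clopen g" "g \<noteq> 0" "r * g = g" "f u * g = 0"
    proof -
      show "clopen g" unfolding g_def by (intro clopen_mult(1) clopen_complement cl)
      show "g \<noteq> 0" using ne rf by (simp add: g_def algebra_simps)
      show "r * g = g" by (simp add: g_def rr)
      have "f u * r = f u" using rf clopen_mult(2)[OF cl(2) cl(3)[of u]] by simp
      then have "f u * g = f u * (1 - f u)" unfolding g_def by (metis mult.assoc)
      then show "f u * g = 0" using clopen_projection(1)[OF cl(3)[of u]] by (simp add: algebra_simps)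
    qed
    note p = pull[OF g(1-3) q'_def u(1)]
    have "f u * (V - a) * q' = - (f u * a * q')"
      using p(3) g(4) by (simp add: algebra_simps) (metis mult.assoc mult_zero_left)
    moreover have "norm (f u * (V - a) * q') < 1/2" using compress cl p(4) by blast
    ultimately show False using p(2) cu by simp
  qed
  have "cmod (c v) < 1/2" if "v \<in> M" "v \<noteq> u" for v
  proof (rule B[OF that(1)])
    have "f u * f v = 0"
      using fS[OF u(1) that(1)] that(2) by (simp add: f_def P_def[of "Y v"] mult.assoc[symmetric])
    then show "r * f v \<noteq> f v" using r by (simp add: f_def)
  qed
  with cu u r show ?thesis unfolding r_def q_def f_def by (metis less_asym')
qed

end

locale cuntz_system = commuting_cuntz_families +
  assumes dense: "closed_cspan (range (\<lambda>(\<mu>, \<nu>). S \<mu> * star (S \<nu>))) = UNIV"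
begin

text \<open>The coefficients of \<open>a * S \<nu>\<close> do not depend on the continuation
  \<open>\<eta>\<close>, so the dominant one, and with it \<open>\<mu>\<close>, is the same for all
  \<open>\<eta>\<close>. Only continuations ending in a marker \<open>\<theta>\<close> are reached
  at this stage.\<close>

lemma normalizing_local_dense:
  assumes V: "normalizing V"
  shows "\<exists>L. \<forall>\<nu>. long L \<nu> \<longrightarrow>
    (\<exists>\<mu>. \<forall>\<eta>. \<exists>\<theta>. V * P (\<nu> \<diamond> \<eta> \<diamond> \<theta>) * star V = P (\<mu> \<diamond> \<eta> \<diamond> \<theta>))"
proof -
  have "V \<in> closure (cspan (range (\<lambda>(\<mu>, \<nu>). S \<mu> * star (S \<nu>))))"
    using dense by (simp add: closed_cspan_def)
  then obtain a where a: "a \<in> cspan (range (\<lambda>(\<mu>, \<nu>). S \<mu> * star (S \<nu>)))" "norm (V - a) < 1/2"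
    by (auto simp: closure_approachable dist_norm norm_minus_commute dest: spec[of _ "1/2"])
  obtain L where L: "\<And>\<nu>. long L \<nu> \<Longrightarrow> a * S \<nu> \<in> cspan (range S)"
    using cspan_S_S_star[OF a(1)] by blast
  have "\<exists>\<mu>. \<forall>\<eta>. \<exists>\<theta>. V * P (\<nu> \<diamond> \<eta> \<diamond> \<theta>) * star V = P (\<mu> \<diamond> \<eta> \<diamond> \<theta>)" if long: "long L \<nu>" for \<nu>
  proof -
    obtain M c where M: "finite M" "M \<subseteq> range S" "a * S \<nu> = (\<Sum>x\<in>M. c x *\<^sub>C x)"
      using L[OF long] unfolding complex_vector.span_explicit by blast
    define u where "u = inv S"
    have u: "S (u x) = x" if "x \<in> M" for x
      using that M(2) by (auto simp: u_def f_inv_into_f)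
    \<comment> \<open>Bounds every word of the expansion in every coordinate, so that one marker
      separates all of them.\<close>
    define K where "K = (\<Sum>x\<in>M. \<Sum>i<m. length (u x i))"
    define \<theta> :: multiword where "\<theta> = (\<lambda>_. replicate K I1 @ [I2])"
    have K: "length (u x i) \<le> K" if "x \<in> M" "i < m" for x i
    proof -
      have "length (u x i) \<le> (\<Sum>i<m. length (u x i))" using that by (intro member_le_sum) auto
      also have "\<dots> \<le> K" unfolding K_def using that M(1)
        by (intro member_le_sum[of x M "\<lambda>x. \<Sum>i<m. length (u x i)"]) auto
      finally show ?thesis .
    qed
    have orth: "star (S (u x \<diamond> \<eta> \<diamond> \<theta>)) * S (u y \<diamond> \<eta> \<diamond> \<theta>) = 0"
      if xy: "x \<in> M" "y \<in> M" "x \<noteq> y" for x y \<eta>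
    proof -
      obtain i where i: "i < m" "u x i \<noteq> u y i"
        using S_cong[of "u x" "u y"] u xy by metis
      show ?thesis by (rule S_marker_orthogonal[where i = i and K = K]) (use K xy i \<theta>_def in auto)
    qed
    have eq: "a * S (\<nu> \<diamond> \<eta> \<diamond> \<theta>) = (\<Sum>x\<in>M. c x *\<^sub>C S (u x \<diamond> \<eta> \<diamond> \<theta>))" for \<eta>
    proof -
      have "a * S (\<nu> \<diamond> \<eta> \<diamond> \<theta>) = (a * S \<nu>) * S (\<eta> \<diamond> \<theta>)" by (simp add: S_mappend mult.assoc)
      also have "\<dots> = (\<Sum>x\<in>M. c x *\<^sub>C (x * S (\<eta> \<diamond> \<theta>)))" by (simp add: M(3) sum_distrib_right scaleC_mult_left)
      also have "\<dots> = (\<Sum>x\<in>M. c x *\<^sub>C S (u x \<diamond> \<eta> \<diamond> \<theta>))"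
        by (rule sum.cong) (simp_all add: S_mappend[of _ "\<eta> \<diamond> \<theta>"] u)
      finally show ?thesis .
    qed
    have dom: "\<exists>x\<in>M. V * P (\<nu> \<diamond> \<eta> \<diamond> \<theta>) * star V = P (u x \<diamond> \<eta> \<diamond> \<theta>) \<and> (\<forall>y\<in>M. 1/2 < cmod (c y) \<longleftrightarrow> y = x)" for \<eta>
      by (rule normalizing_dominant_coefficient[OF V a(2) M(1) eq orth])
    \<comment> \<open>Any single \<open>\<eta>\<close> identifies the dominant index; the empty one
      is taken.\<close>
    from dom[of "\<lambda>_. []"] obtain x where x: "x \<in> M" "\<And>y. y \<in> M \<Longrightarrow> 1/2 < cmod (c y) \<longleftrightarrow> y = x" by blast
    have "V * P (\<nu> \<diamond> \<eta> \<diamond> \<theta>) * star V = P (u x \<diamond> \<eta> \<diamond> \<theta>)" for \<eta>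
      using dom[of \<eta>] x by metis
    then show ?thesis by blast
  qed
  then show ?thesis by blast
qed

text \<open>Marked subcylinders are dense: a discrepancy between the image of
  \<open>P (\<nu> \<diamond> \<eta>)\<close> and \<open>P (\<mu> \<diamond> \<eta>)\<close> would be
  clopen and nonzero, hence contain a marked cylinder, where the two agree.\<close>

lemma normalizing_local:
  assumes V: "normalizing V"
  shows "\<exists>L. \<forall>\<nu>. long L \<nu> \<longrightarrow> (\<exists>\<mu>. \<forall>\<eta>. V * P (\<nu> \<diamond> \<eta>) * star V = P (\<mu> \<diamond> \<eta>))"
proof -
  have VV [simp]: "star V * V = 1" "V * star V = 1"
    using V by (auto simp: normalizing_def)
  have [simp]: "star V * (V * x) = x" "V * (star V * x) = x" for x
    by (metis VV mult.assoc mult_1)+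
  obtain L where L: "\<And>\<nu>. long L \<nu> \<Longrightarrow>
    \<exists>\<mu>. \<forall>\<eta>. \<exists>\<theta>. V * P (\<nu> \<diamond> \<eta> \<diamond> \<theta>) * star V = P (\<mu> \<diamond> \<eta> \<diamond> \<theta>)"
    using normalizing_local_dense[OF V] by blast
  have "\<exists>\<mu>. \<forall>\<eta>. V * P (\<nu> \<diamond> \<eta>) * star V = P (\<mu> \<diamond> \<eta>)" if long: "long L \<nu>" for \<nu>
  proof -
    obtain \<mu> where \<mu>: "\<And>\<eta>. \<exists>\<theta>. V * P (\<nu> \<diamond> \<eta> \<diamond> \<theta>) * star V = P (\<mu> \<diamond> \<eta> \<diamond> \<theta>)"
      using L[OF long] by blast
    have "V * P (\<nu> \<diamond> \<eta>) * star V = P (\<mu> \<diamond> \<eta>)" for \<eta>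
    proof -
      define r where "r = V * P (\<nu> \<diamond> \<eta>) * star V"
      define f where "f = P (\<mu> \<diamond> \<eta>)"
      have cl: "clopen r" "clopen f" using V clopen_P by (auto simp: r_def f_def normalizing_def)
      note comm = clopen_mult(2)[OF cl]
      have sub: "\<exists>\<theta>. r * P (\<mu> \<diamond> \<eta> \<diamond> \<zeta> \<diamond> \<theta>) = P (\<mu> \<diamond> \<eta> \<diamond> \<zeta> \<diamond> \<theta>)
          \<and> V * P (\<nu> \<diamond> \<eta> \<diamond> \<zeta> \<diamond> \<theta>) * star V = P (\<mu> \<diamond> \<eta> \<diamond> \<zeta> \<diamond> \<theta>)" for \<zeta>
      proof -
        obtain \<theta> where \<theta>: "V * P (\<nu> \<diamond> \<eta> \<diamond> \<zeta> \<diamond> \<theta>) * star V = P (\<mu> \<diamond> \<eta> \<diamond> \<zeta> \<diamond> \<theta>)"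
          using \<mu>[of "\<eta> \<diamond> \<zeta>"] by (auto simp: mappend_assoc)
        have "P (\<nu> \<diamond> \<eta>) * P (\<nu> \<diamond> \<eta> \<diamond> \<zeta> \<diamond> \<theta>) = P (\<nu> \<diamond> \<eta> \<diamond> \<zeta> \<diamond> \<theta>)"
          using P_mult_P_mappend[of "\<nu> \<diamond> \<eta>" "\<zeta> \<diamond> \<theta>"] by (simp add: mappend_assoc)
        then have "r * (V * P (\<nu> \<diamond> \<eta> \<diamond> \<zeta> \<diamond> \<theta>) * star V) = V * P (\<nu> \<diamond> \<eta> \<diamond> \<zeta> \<diamond> \<theta>) * star V"
          by (simp add: r_def mult.assoc) (metis mult.assoc)
        with \<theta> show ?thesis by auto
      qed
      have below: "x * P (\<alpha> \<diamond> \<zeta> \<diamond> \<theta>) = P (\<alpha> \<diamond> \<zeta> \<diamond> \<theta>)" if "x * S (\<alpha> \<diamond> \<zeta>) = S (\<alpha> \<diamond> \<zeta>)" for x \<alpha> \<zeta> \<theta>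
      proof -
        have "P (\<alpha> \<diamond> \<zeta> \<diamond> \<theta>) = S (\<alpha> \<diamond> \<zeta>) * (P \<theta> * star (S (\<alpha> \<diamond> \<zeta>)))"
          by (simp add: P_mappend[of "\<alpha> \<diamond> \<zeta>" \<theta>, unfolded mappend_assoc] mult.assoc)
        with that show ?thesis by (metis mult.assoc)
      qed
      have "(1 - r) * f = 0"
      proof (rule ccontr)
        assume nz: "(1 - r) * f \<noteq> 0"
        have "(1 - r) * f * P (\<mu> \<diamond> \<eta>) = (1 - r) * f" by (simp add: f_def mult.assoc)
        then obtain \<zeta> where \<zeta>: "(1 - r) * f * S ((\<mu> \<diamond> \<eta>) \<diamond> \<zeta>) = S ((\<mu> \<diamond> \<eta>) \<diamond> \<zeta>)"
          using clopen_nonzero_below[OF clopen_mult(1)[OF clopen_complement[OF cl(1)] cl(2)] nz] by blast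
        obtain \<theta> where \<theta>: "r * P (\<mu> \<diamond> \<eta> \<diamond> \<zeta> \<diamond> \<theta>) = P (\<mu> \<diamond> \<eta> \<diamond> \<zeta> \<diamond> \<theta>)" using sub by blast
        have "(1 - r) * f * P (\<mu> \<diamond> \<eta> \<diamond> \<zeta> \<diamond> \<theta>) = P (\<mu> \<diamond> \<eta> \<diamond> \<zeta> \<diamond> \<theta>)"
          using below[OF \<zeta>, of \<theta>] by (simp add: mappend_assoc)
        then have "r * P (\<mu> \<diamond> \<eta> \<diamond> \<zeta> \<diamond> \<theta>) = r * (1 - r) * f * P (\<mu> \<diamond> \<eta> \<diamond> \<zeta> \<diamond> \<theta>)"
          by (metis mult.assoc)
        also have "r * (1 - r) = 0" using clopen_projection(1)[OF cl(1)] by (simp add: algebra_simps)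
        finally show False using \<theta> by simp
      qed
      \<comment> \<open>\<open>r\<close> is not yet known to be a cylinder, so the remainder is
        pulled back by \<open>V\<close> into \<open>P (\<nu> \<diamond> \<eta>)\<close> before a
        subcylinder is chosen.\<close>
      moreover have "r * (1 - f) = 0"
      proof (rule ccontr)
        assume nz: "r * (1 - f) \<noteq> 0"
        define g where "g = r * (1 - f)"
        define q where "q = star V * g * V"
        have g: "clopen g" unfolding g_def by (intro clopen_mult(1) clopen_complement cl)
        have q: "clopen q" using V g by (simp add: q_def normalizing_def)
        have VqV: "V * q * star V = g" by (simp add: q_def mult.assoc)
        with nz have q0: "q \<noteq> 0" by (auto simp: g_def)
        have gr: "g * r = g"
          using clopen_mult(2)[OF g cl(1)] clopen_projection(1)[OF cl(1)] by (simp add: g_def mult.assoc[symmetric])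
        have "q * P (\<nu> \<diamond> \<eta>) = star V * (g * r) * V" by (simp add: q_def r_def mult.assoc)
        then have "q * P (\<nu> \<diamond> \<eta>) = q" by (simp add: gr q_def)
        then obtain \<zeta> where \<zeta>: "q * S ((\<nu> \<diamond> \<eta>) \<diamond> \<zeta>) = S ((\<nu> \<diamond> \<eta>) \<diamond> \<zeta>)"
          using clopen_nonzero_below[OF q q0] by blast
        obtain \<theta> where \<theta>: "V * P (\<nu> \<diamond> \<eta> \<diamond> \<zeta> \<diamond> \<theta>) * star V = P (\<mu> \<diamond> \<eta> \<diamond> \<zeta> \<diamond> \<theta>)" using sub by blast
        have qP: "q * P (\<nu> \<diamond> \<eta> \<diamond> \<zeta> \<diamond> \<theta>) = P (\<nu> \<diamond> \<eta> \<diamond> \<zeta> \<diamond> \<theta>)"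
          using below[OF \<zeta>, of \<theta>] by (simp add: mappend_assoc)
        have "g * (V * P (\<nu> \<diamond> \<eta> \<diamond> \<zeta> \<diamond> \<theta>) * star V) = V * (q * P (\<nu> \<diamond> \<eta> \<diamond> \<zeta> \<diamond> \<theta>)) * star V"
          by (simp add: q_def mult.assoc)
        then have gP: "g * P (\<mu> \<diamond> \<eta> \<diamond> \<zeta> \<diamond> \<theta>) = P (\<mu> \<diamond> \<eta> \<diamond> \<zeta> \<diamond> \<theta>)" using qP \<theta> by simp
        have "f * P (\<mu> \<diamond> \<eta> \<diamond> \<zeta> \<diamond> \<theta>) = P (\<mu> \<diamond> \<eta> \<diamond> \<zeta> \<diamond> \<theta>)"
          using P_mult_P_mappend[of "\<mu> \<diamond> \<eta>" "\<zeta> \<diamond> \<theta>"] by (simp add: f_def mappend_assoc)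
        then have "g * P (\<mu> \<diamond> \<eta> \<diamond> \<zeta> \<diamond> \<theta>) = g * f * P (\<mu> \<diamond> \<eta> \<diamond> \<zeta> \<diamond> \<theta>)" by (metis mult.assoc)
        also have "g * f = 0" using clopen_projection(1)[OF cl(2)] by (simp add: g_def algebra_simps)
        finally show False using gP by simp
      qed
      ultimately have "r = f" by (simp add: algebra_simps)
      then show ?thesis by (simp add: r_def f_def)
    qed
    then show ?thesis by blast
  qed
  then show ?thesis by blast
qed

end

section \<open>Degrees at a fixed point\<close>

text \<open>Exponents below \<open>N\<close> give \<open>N ^ n\<close> vectors, while the values lie
  in a box with \<open>(2 * N * C + 1) ^ m\<close> points. Two equal combinations are sought instead
  of a vanishing one, so that all exponents are natural numbers.\<close>

lemma pigeonhole_linear: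
  fixes d :: "nat \<Rightarrow> nat \<Rightarrow> int"
  assumes "m < n"
  shows "\<exists>(k :: nat \<Rightarrow> nat) k'. (\<exists>j<n. k j \<noteq> k' j) \<and>
    (\<forall>i<m. (\<Sum>j<n. int (k j) * d j i) = (\<Sum>j<n. int (k' j) * d j i))"
proof -
  define C where "C = nat (\<Sum>j<n. \<Sum>i<m. \<bar>d j i\<bar>)"
  \<comment> \<open>Chosen so that
    \<open>(2 * C + 1) ^ m * N ^ m < N * N ^ m \<le> N ^ n\<close>.\<close>
  define N where "N = (2 * C + 1) ^ m + 1"
  define F where "F k = restrict (\<lambda>i. \<Sum>j<n. int (k j) * d j i) {..<m}" for k :: "nat \<Rightarrow> nat"
  let ?A = "PiE {..<n} (\<lambda>_. {..<N})"
  let ?B = "PiE {..<m} (\<lambda>_. {- int (N * C) .. int (N * C)})"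
  have "F ` ?A \<subseteq> ?B"
  proof (rule image_subsetI, rule PiE_I)
    fix k i assume k: "k \<in> ?A" and i: "i \<in> {..<m}"
    have "\<bar>\<Sum>j<n. int (k j) * d j i\<bar> \<le> (\<Sum>j<n. int N * (\<Sum>i<m. \<bar>d j i\<bar>))"
    proof (rule order_trans[OF sum_abs], rule sum_mono)
      fix j assume "j \<in> {..<n}"
      with k have "k j < N" by auto
      moreover have "\<bar>d j i\<bar> \<le> (\<Sum>i<m. \<bar>d j i\<bar>)"
        using i by (intro member_le_sum) auto
      ultimately show "\<bar>int (k j) * d j i\<bar> \<le> int N * (\<Sum>i<m. \<bar>d j i\<bar>)"
        unfolding abs_mult by (intro mult_mono) auto
    qed
    also have "\<dots> = int (N * C)"
      by (simp add: C_def sum_distrib_left sum_nonneg)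
    finally show "F k i \<in> {- int (N * C) .. int (N * C)}" using i by (simp add: F_def abs_le_iff)
  qed (simp add: F_def)
  moreover have "card ?B < card ?A"
  proof -
    have "card ?B = (2 * N * C + 1) ^ m" by (simp add: card_PiE nat_add_distrib nat_mult_distrib mult.assoc mult.commute)
    also have "\<dots> \<le> ((2 * C + 1) * N) ^ m"
      by (intro power_mono) (auto simp: N_def distrib_right)
    also have "\<dots> = (2 * C + 1) ^ m * N ^ m" by (rule power_mult_distrib)
    also have "\<dots> < N * N ^ m" by (rule mult_strict_right_mono) (simp_all add: N_def)
    also have "\<dots> \<le> N ^ n" using assms by (simp add: power_Suc[symmetric] power_increasing N_def del: power_Suc)
    also have "\<dots> = card ?A" by (simp add: card_PiE)
    finally show ?thesis .
  qed
  moreover have "finite ?B" by (intro finite_PiE) auto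
  ultimately have "\<not> inj_on F ?A" using card_inj_on_le leD by blast
  then obtain k k' where k: "k \<in> ?A" "k' \<in> ?A" "k \<noteq> k'" "F k = F k'" by (auto simp: inj_on_def)
  then obtain j where j: "j < n" "k j \<noteq> k' j" by (metis PiE_ext lessThan_iff)
  have "\<forall>i<m. (\<Sum>j<n. int (k j) * d j i) = (\<Sum>j<n. int (k' j) * d j i)"
    using k(4) by (auto simp: F_def fun_eq_iff split: if_splits)
  with j show ?thesis by blast
qed

context commuting_cuntz_families
begin

lemma normalizing_unitary:
  assumes "normalizing V"
  shows "star V * V = 1" "V * star V = 1"
  using assms by (auto simp: normalizing_def)

lemma normalizing_one: "normalizing 1"
  by (simp add: normalizing_def star_one)

lemma unitary_mult:
  assumes "star U * U = 1" "star V * V = (1 :: 'a)"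
  shows "star (U * V) * (U * V) = 1"
proof -
  have "star (U * V) * (U * V) = star V * (star U * U) * V" by (simp add: star_mult mult.assoc)
  with assms show ?thesis by simp
qed

lemma normalizing_mult:
  assumes U: "normalizing U" and V: "normalizing V"
  shows "normalizing (U * V)"
  unfolding normalizing_def
proof (intro conjI allI impI)
  show "star (U * V) * (U * V) = 1"
    using unitary_mult normalizing_unitary[OF U] normalizing_unitary[OF V] by blast
  show "U * V * star (U * V) = 1"
    using unitary_mult[of "star V" "star U"] normalizing_unitary[OF U] normalizing_unitary[OF V]
    by (simp add: star_mult star_star)
  fix q assume "clopen q"
  then have "clopen (U * (V * q * star V) * star U)" "clopen (star V * (star U * q * U) * V)"
    using U V by (auto simp: normalizing_def)
  then show "clopen (U * V * q * star (U * V))" "clopen (star (U * V) * q * (U * V))"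
    by (simp_all add: star_mult mult.assoc)
qed

end

text \<open>An ultrafilter of clopen projections plays the role of a point of the spectrum of the diagonal.\<close>

locale cuntz_ultrafilter = cuntz_system +
  fixes Fil :: "'a \<Rightarrow> bool"
  assumes Fil_mult: "Fil q \<Longrightarrow> Fil r \<Longrightarrow> Fil (q * r)"
    and Fil_complement: "clopen q \<Longrightarrow> Fil q \<or> Fil (1 - q)"
    and not_Fil_0: "\<not> Fil 0"
begin

definition stabilizing :: "'a \<Rightarrow> bool" where
  "stabilizing V \<longleftrightarrow> normalizing V \<and> (\<forall>q. Fil q \<longrightarrow> Fil (V * q * star V) \<and> Fil (star V * q * V))"

text \<open>\<open>\<nu>\<close> and \<open>\<mu>\<close> are both initial segments of the fixed
  point, so below \<open>m\<close> their lengths determine them. Coordinates of \<open>d\<close>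
  from \<open>m\<close> on are unconstrained.\<close>

definition has_degree :: "'a \<Rightarrow> (nat \<Rightarrow> int) \<Rightarrow> bool" where
  "has_degree V d \<longleftrightarrow> (\<exists>\<nu> \<mu>. Fil (P \<nu>) \<and> Fil (P \<mu>) \<and>
     (\<forall>i<m. int (length (\<mu> i)) - int (length (\<nu> i)) = d i) \<and>
     (\<forall>\<eta>. V * P (\<nu> \<diamond> \<eta>) * star V = P (\<mu> \<diamond> \<eta>)))"

lemma Fil_one: "Fil 1"
  using Fil_complement[OF clopen_0] not_Fil_0 by simp

text \<open>Compactness: if every long cylinder were disjoint from some member of the filter, finite
  intersections would give a member disjoint from 1.\<close>

lemma Fil_long_word:
  obtains \<nu> where "long L \<nu>" "Fil (P \<nu>)"
proof (rule ccontr)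
  assume "\<not> thesis"
  with that have no: "\<not> Fil (P \<nu>)" if "long L \<nu>" for \<nu> using that by blast
  have "1 \<in> {x. \<exists>q. clopen q \<and> Fil q \<and> x * q = 0}"
  proof (rule split_induct[of _ L])
    fix \<nu> assume "long L \<nu>"
    then have "Fil (1 - P \<nu>)" using no Fil_complement[OF clopen_P] by blast
    moreover have "P \<nu> * (1 - P \<nu>) = 0" by (simp add: right_diff_distrib)
    ultimately show "P \<nu> \<in> {x. \<exists>q. clopen q \<and> Fil q \<and> x * q = 0}"
      using clopen_complement[OF clopen_P] by blast
  next
    fix x y assume "x \<in> {x. \<exists>q. clopen q \<and> Fil q \<and> x * q = 0}" "y \<in> {x. \<exists>q. clopen q \<and> Fil q \<and> x * q = 0}"
    then obtain q r where q: "clopen q" "Fil q" "x * q = 0" and r: "clopen r" "Fil r" "y * r = 0" by blast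
    have "x * (q * r) = 0" using q(3) by (simp add: mult.assoc[symmetric])
    moreover have "y * (q * r) = 0" using r(3) clopen_mult(2)[OF q(1) r(1)] by (simp add: mult.assoc[symmetric])
    ultimately have "(x + y) * (q * r) = 0" by (simp add: distrib_right)
    then show "x + y \<in> {x. \<exists>q. clopen q \<and> Fil q \<and> x * q = 0}"
      using clopen_mult(1)[OF q(1) r(1)] Fil_mult[OF q(2) r(2)] by blast
  qed
  then show False using not_Fil_0 by auto
qed

lemma Fil_covers:
  assumes "Fil (P \<nu>)" "Fil (P \<zeta>)" "\<And>i. i < m \<Longrightarrow> length (\<nu> i) \<le> length (\<zeta> i)"
  shows "covers \<nu> \<zeta>"
proof (rule ccontr)
  assume "\<not> ?thesis"
  then have "P \<nu> * P \<zeta> = 0" using P_S[of \<nu> \<zeta>] assms(3) by (simp add: P_def[of \<zeta>] mult.assoc[symmetric])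
  then show False using Fil_mult[OF assms(1,2)] not_Fil_0 by simp
qed

text \<open>Both multiwords are initial segments of the same point, and any longer initial segment
  extends both.\<close>

lemma Fil_extension:
  assumes "Fil (P \<nu>)" "Fil (P \<mu>)"
  shows "\<exists>\<eta> \<eta>'. Fil (P (\<nu> \<diamond> \<eta>)) \<and> (\<forall>i<m. (\<nu> \<diamond> \<eta>) i = (\<mu> \<diamond> \<eta>') i)"
proof -
  define L where "L = (\<Sum>i<m. length (\<nu> i) + length (\<mu> i))"
  obtain \<zeta> where \<zeta>: "long L \<zeta>" "Fil (P \<zeta>)" using Fil_long_word .
  have L: "length (\<nu> i) + length (\<mu> i) \<le> length (\<zeta> i)" if "i < m" for i
  proof -
    have "length (\<nu> i) + length (\<mu> i) \<le> L"
      unfolding L_def using that by (intro member_le_sum[of i "{..<m}" "\<lambda>i. length (\<nu> i) + length (\<mu> i)"]) auto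
    then show ?thesis using \<zeta>(1) that unfolding long_def by (meson order_trans)
  qed
  have "covers \<nu> \<zeta>" "covers \<mu> \<zeta>"
    by (rule Fil_covers[OF _ \<zeta>(2)]; use assms L add_leD1 add_leD2 in blast)+
  then obtain \<eta> \<eta>' where "\<And>i. i < m \<Longrightarrow> \<zeta> i = (\<nu> \<diamond> \<eta>) i" "\<And>i. i < m \<Longrightarrow> \<zeta> i = (\<mu> \<diamond> \<eta>') i"
    by (metis coversD)
  moreover from this(1) have "P \<zeta> = P (\<nu> \<diamond> \<eta>)" by (rule P_cong)
  ultimately show ?thesis using \<zeta>(2) by metis
qed

lemma stabilizing_mult:
  assumes "stabilizing U" "stabilizing V"
  shows "stabilizing (U * V)"
proof -
  have "Fil (U * V * q * star (U * V))" "Fil (star (U * V) * q * (U * V))" if "Fil q" for q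
  proof -
    have "Fil (U * (V * q * star V) * star U)" "Fil (star V * (star U * q * U) * V)"
      using assms that by (auto simp: stabilizing_def)
    then show "Fil (U * V * q * star (U * V))" "Fil (star (U * V) * q * (U * V))"
      by (simp_all add: star_mult mult.assoc)
  qed
  with assms normalizing_mult show ?thesis by (auto simp: stabilizing_def)
qed

lemma stabilizing_degree:
  assumes "stabilizing V"
  shows "\<exists>d. has_degree V d"
proof -
  have V: "normalizing V" "\<And>q. Fil q \<Longrightarrow> Fil (V * q * star V)"
    using assms by (auto simp: stabilizing_def)
  obtain L where L: "\<And>\<nu>. long L \<nu> \<Longrightarrow> \<exists>\<mu>. \<forall>\<eta>. V * P (\<nu> \<diamond> \<eta>) * star V = P (\<mu> \<diamond> \<eta>)"
    using normalizing_local[OF V(1)] by blast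
  obtain \<nu> where \<nu>: "long L \<nu>" "Fil (P \<nu>)" using Fil_long_word .
  then obtain \<mu> where \<mu>: "\<And>\<eta>. V * P (\<nu> \<diamond> \<eta>) * star V = P (\<mu> \<diamond> \<eta>)" using L by blast
  have "\<alpha> \<diamond> (\<lambda>_. []) = \<alpha>" for \<alpha> by (simp add: fun_eq_iff mappend_def)
  then have "V * P \<nu> * star V = P \<mu>" using \<mu>[of "\<lambda>_. []"] by simp
  then have "Fil (P \<mu>)" using V(2)[OF \<nu>(2)] by simp
  with \<mu> \<nu>(2) show ?thesis unfolding has_degree_def
    by (intro exI[of _ "\<lambda>i. int (length (\<mu> i)) - int (length (\<nu> i))"] exI[of _ \<nu>] exI[of _ \<mu>]) simp
qed

lemma degree_one: "has_degree 1 (\<lambda>_. 0)"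
  unfolding has_degree_def by (rule exI[of _ "\<lambda>_. []"], rule exI[of _ "\<lambda>_. []"]) (simp add: Fil_one star_one)

text \<open>Prefix replacements compose once the output prefix of \<open>V\<close> and the input
  prefix of \<open>U\<close> are matched by a common extension; extending both sides of a
  replacement by the same word leaves the length difference unchanged.\<close>

lemma degree_mult:
  assumes U: "stabilizing U" "has_degree U d" and V: "stabilizing V" "has_degree V e"
  shows "has_degree (U * V) (\<lambda>i. d i + e i)"
proof -
  obtain \<nu> \<mu> where \<nu>: "Fil (P \<nu>)" "Fil (P \<mu>)" "\<And>i. i < m \<Longrightarrow> int (length (\<mu> i)) - int (length (\<nu> i)) = e i"
    "\<And>\<eta>. V * P (\<nu> \<diamond> \<eta>) * star V = P (\<mu> \<diamond> \<eta>)"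
    using V(2) by (auto simp: has_degree_def)
  obtain \<kappa> \<rho> where \<kappa>: "Fil (P \<kappa>)" "Fil (P \<rho>)" "\<And>i. i < m \<Longrightarrow> int (length (\<rho> i)) - int (length (\<kappa> i)) = d i"
    "\<And>\<eta>. U * P (\<kappa> \<diamond> \<eta>) * star U = P (\<rho> \<diamond> \<eta>)"
    using U(2) by (auto simp: has_degree_def)
  obtain \<eta> \<eta>' where \<eta>: "Fil (P (\<mu> \<diamond> \<eta>))" "\<And>i. i < m \<Longrightarrow> (\<mu> \<diamond> \<eta>) i = (\<kappa> \<diamond> \<eta>') i"
    using Fil_extension[OF \<nu>(2) \<kappa>(1)] by blast
  have VV: "star V * V = 1" using V(1) normalizing_unitary by (auto simp: stabilizing_def)
  have "star V * P (\<mu> \<diamond> \<eta>) * V = (star V * V) * P (\<nu> \<diamond> \<eta>) * (star V * V)"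
    by (simp add: \<nu>(4)[symmetric] mult.assoc)
  then have "star V * P (\<mu> \<diamond> \<eta>) * V = P (\<nu> \<diamond> \<eta>)" by (simp add: VV)
  then have F1: "Fil (P (\<nu> \<diamond> \<eta>))" using V(1) \<eta>(1) unfolding stabilizing_def by metis
  have "P (\<mu> \<diamond> \<eta>) = P (\<kappa> \<diamond> \<eta>')" by (rule P_cong) (rule \<eta>(2))
  then have "U * P (\<mu> \<diamond> \<eta>) * star U = P (\<rho> \<diamond> \<eta>')" by (simp add: \<kappa>(4))
  then have F2: "Fil (P (\<rho> \<diamond> \<eta>'))" using U(1) \<eta>(1) unfolding stabilizing_def by metis
  show ?thesis unfolding has_degree_def
  proof (intro exI conjI allI impI)
    show "Fil (P (\<nu> \<diamond> \<eta>))" "Fil (P (\<rho> \<diamond> \<eta>'))" by fact+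
    fix \<theta>
    have "U * V * P ((\<nu> \<diamond> \<eta>) \<diamond> \<theta>) * star (U * V) = U * (V * P (\<nu> \<diamond> \<eta> \<diamond> \<theta>) * star V) * star U"
      by (simp add: star_mult mult.assoc mappend_assoc)
    also have "\<dots> = U * P (\<mu> \<diamond> \<eta> \<diamond> \<theta>) * star U" by (simp add: \<nu>(4))
    also have "P (\<mu> \<diamond> \<eta> \<diamond> \<theta>) = P (\<kappa> \<diamond> \<eta>' \<diamond> \<theta>)"
      by (rule P_cong) (use \<eta>(2) in \<open>auto simp: mappend_def append_assoc[symmetric] simp del: append_assoc\<close>)
    finally show "U * V * P ((\<nu> \<diamond> \<eta>) \<diamond> \<theta>) * star (U * V) = P ((\<rho> \<diamond> \<eta>') \<diamond> \<theta>)"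
      by (simp add: \<kappa>(4) mappend_assoc)
  next
    fix i assume i: "i < m"
    have "length ((\<mu> \<diamond> \<eta>) i) = length ((\<kappa> \<diamond> \<eta>') i)" using \<eta>(2)[OF i] by simp
    then have "int (length (\<mu> i)) + int (length (\<eta> i)) = int (length (\<kappa> i)) + int (length (\<eta>' i))"
      by (simp add: mappend_def)
    then show "int (length ((\<rho> \<diamond> \<eta>') i)) - int (length ((\<nu> \<diamond> \<eta>) i)) = d i + e i"
      using \<nu>(3)[OF i] \<kappa>(3)[OF i] by (simp add: mappend_def)
  qed
qed

lemma stabilizing_one: "stabilizing 1"
  by (simp add: stabilizing_def normalizing_one star_one)

lemma degree_power:
  assumes "stabilizing V" "has_degree V d"
  shows "stabilizing (V ^ k) \<and> has_degree (V ^ k) (\<lambda>i. int k * d i)"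
proof (induction k)
  case (Suc k)
  then show ?case
    using stabilizing_mult[OF assms(1), of "V ^ k"] degree_mult[OF assms, of "V ^ k"]
    by (auto simp: distrib_right)
qed (simp add: stabilizing_one degree_one)

lemma degree_ordered_prod:
  assumes "\<And>j. j < n \<Longrightarrow> stabilizing (V j)" "\<And>j. j < n \<Longrightarrow> has_degree (V j) (d j)"
  shows "stabilizing (ordered_prod (\<lambda>j. V j ^ k j) n) \<and>
    has_degree (ordered_prod (\<lambda>j. V j ^ k j) n) (\<lambda>i. \<Sum>j<n. int (k j) * d j i)"
  using assms
proof (induction n)
  case (Suc n)
  then have "stabilizing (V n ^ k n)" "has_degree (V n ^ k n) (\<lambda>i. int (k n) * d n i)"
    using degree_power[of "V n" "d n"] by auto
  moreover have "stabilizing (ordered_prod (\<lambda>j. V j ^ k j) n)"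
    "has_degree (ordered_prod (\<lambda>j. V j ^ k j) n) (\<lambda>i. \<Sum>j<n. int (k j) * d j i)"
    using Suc by auto
  ultimately show ?case using stabilizing_mult degree_mult by simp
qed (simp add: stabilizing_one degree_one)

text \<open>On a common domain prefix, the two image prefixes are initial segments of the same point
  with equal lengths, hence equal; then the actions on all subcylinders coincide.\<close>

lemma degree_agree:
  assumes "has_degree U d" "stabilizing U" "has_degree V d" "stabilizing V"
  obtains \<nu> where "Fil (P \<nu>)" "\<And>\<eta>. U * P (\<nu> \<diamond> \<eta>) * star U = V * P (\<nu> \<diamond> \<eta>) * star V"
proof -
  obtain \<nu> \<mu> where \<nu>: "Fil (P \<nu>)" "Fil (P \<mu>)" "\<And>i. i < m \<Longrightarrow> int (length (\<mu> i)) - int (length (\<nu> i)) = d i"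
    "\<And>\<eta>. U * P (\<nu> \<diamond> \<eta>) * star U = P (\<mu> \<diamond> \<eta>)"
    using assms(1) by (auto simp: has_degree_def)
  obtain \<kappa> \<rho> where \<kappa>: "Fil (P \<kappa>)" "Fil (P \<rho>)" "\<And>i. i < m \<Longrightarrow> int (length (\<rho> i)) - int (length (\<kappa> i)) = d i"
    "\<And>\<eta>. V * P (\<kappa> \<diamond> \<eta>) * star V = P (\<rho> \<diamond> \<eta>)"
    using assms(3) by (auto simp: has_degree_def)
  obtain \<eta> \<eta>' where \<eta>: "Fil (P (\<nu> \<diamond> \<eta>))" "\<And>i. i < m \<Longrightarrow> (\<nu> \<diamond> \<eta>) i = (\<kappa> \<diamond> \<eta>') i"
    using Fil_extension[OF \<nu>(1) \<kappa>(1)] by blast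
  have F1: "Fil (P (\<mu> \<diamond> \<eta>))" using assms(2) \<eta>(1) \<nu>(4)[of \<eta>] unfolding stabilizing_def by metis
  have "P (\<nu> \<diamond> \<eta>) = P (\<kappa> \<diamond> \<eta>')" by (rule P_cong) (rule \<eta>(2))
  then have F2: "Fil (P (\<rho> \<diamond> \<eta>'))" using assms(4) \<eta>(1) \<kappa>(4)[of \<eta>'] unfolding stabilizing_def by metis
  have len: "length ((\<mu> \<diamond> \<eta>) i) = length ((\<rho> \<diamond> \<eta>') i)" if i: "i < m" for i
  proof -
    have "length ((\<nu> \<diamond> \<eta>) i) = length ((\<kappa> \<diamond> \<eta>') i)" using \<eta>(2)[OF i] by simp
    then show ?thesis using \<nu>(3)[OF i] \<kappa>(3)[OF i] by (simp add: mappend_def)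
  qed
  have eq: "(\<mu> \<diamond> \<eta>) i = (\<rho> \<diamond> \<eta>') i" if "i < m" for i
    using Fil_covers[OF F1 F2] len that unfolding covers_def by (metis order_refl take_all)
  show ?thesis
  proof (rule that[OF \<eta>(1)])
    fix \<theta>
    have "P ((\<nu> \<diamond> \<eta>) \<diamond> \<theta>) = P (\<kappa> \<diamond> \<eta>' \<diamond> \<theta>)" "P (\<mu> \<diamond> \<eta> \<diamond> \<theta>) = P (\<rho> \<diamond> \<eta>' \<diamond> \<theta>)"
      by (rule P_cong; use \<eta>(2) eq in \<open>auto simp: mappend_def append_assoc[symmetric] simp del: append_assoc\<close>)+
    then show "U * P ((\<nu> \<diamond> \<eta>) \<diamond> \<theta>) * star U = V * P ((\<nu> \<diamond> \<eta>) \<diamond> \<theta>) * star V"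
      using \<nu>(4)[of "\<eta> \<diamond> \<theta>"] \<kappa>(4)[of "\<eta>' \<diamond> \<theta>"] by (simp add: mappend_assoc)
  qed
qed

lemma stabilizer_relation:
  assumes "m < n" and V: "\<And>j. j < n \<Longrightarrow> stabilizing (V j)"
  shows "\<exists>(k :: nat \<Rightarrow> nat) k' \<nu>. (\<exists>j<n. k j \<noteq> k' j) \<and> Fil (P \<nu>) \<and>
    (\<forall>\<eta>. ordered_prod (\<lambda>j. V j ^ k j) n * P (\<nu> \<diamond> \<eta>) * star (ordered_prod (\<lambda>j. V j ^ k j) n)
      = ordered_prod (\<lambda>j. V j ^ k' j) n * P (\<nu> \<diamond> \<eta>) * star (ordered_prod (\<lambda>j. V j ^ k' j) n))"
proof -
  obtain d where d: "\<And>j. j < n \<Longrightarrow> has_degree (V j) (d j)" using stabilizing_degree[OF V]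
    by (intro that[of "\<lambda>j. SOME d. has_degree (V j) d"]) (simp add: someI_ex)
  obtain k k' j where j: "j < n" "k j \<noteq> k' j"
    and eq: "\<And>i. i < m \<Longrightarrow> (\<Sum>j<n. int (k j) * d j i) = (\<Sum>j<n. int (k' j) * d j i)"
    using pigeonhole_linear[OF assms(1), of d] by blast
  note D = degree_ordered_prod[of n V d, OF V d]
  \<comment> \<open>\<open>has_degree\<close> sees only coordinates below \<open>m\<close>, which is
    where the sums agree.\<close>
  have deg': "has_degree (ordered_prod (\<lambda>j. V j ^ k' j) n) (\<lambda>i. \<Sum>j<n. int (k j) * d j i)"
    using D[of k'] eq by (simp add: has_degree_def)
  obtain \<nu> where "Fil (P \<nu>)" "\<And>\<eta>. ordered_prod (\<lambda>j. V j ^ k j) n * P (\<nu> \<diamond> \<eta>) * star (ordered_prod (\<lambda>j. V j ^ k j) n)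
      = ordered_prod (\<lambda>j. V j ^ k' j) n * P (\<nu> \<diamond> \<eta>) * star (ordered_prod (\<lambda>j. V j ^ k' j) n)"
    using degree_agree[OF conjunct2[OF D[of k]] conjunct1[OF D[of k]] deg' conjunct1[OF D[of k']]] by blast
  with j show ?thesis by blast
qed

end

section \<open>Thompson unitaries\<close>

text \<open>The unitary of \<open>\<O>\<^sub>2\<close> corresponding to a generator of Thompson's group \<open>F\<close>: it replaces
  the prefixes \<open>11, 12, 2\<close> by \<open>1, 21, 22\<close>.\<close>

definition thompson :: "(cuntz_index \<Rightarrow> 'a :: unital_cstar_algebra) \<Rightarrow> 'a" where
  "thompson s = s I1 * star (s I1) * star (s I1) + s I2 * s I1 * star (s I2) * star (s I1)
     + s I2 * s I2 * star (s I2)"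

fun contract :: "cuntz_index list \<Rightarrow> cuntz_index list" where
  "contract (I1 # I1 # w) = I1 # w"
| "contract (I1 # I2 # w) = I2 # I1 # w"
| "contract (I2 # w) = I2 # I2 # w"
| "contract w = w"

fun expand :: "cuntz_index list \<Rightarrow> cuntz_index list" where
  "expand (I1 # w) = I1 # I1 # w"
| "expand (I2 # I1 # w) = I1 # I2 # w"
| "expand (I2 # I2 # w) = I2 # w"
| "expand w = w"

text \<open>Shorter words can fall into the default clauses, hence the bound 2. Losing at most one
  letter keeps long words long under \<open>W i\<close>.\<close>

lemma expand_contract: "2 \<le> length w \<Longrightarrow> expand (contract w) = w"
  and length_contract: "length w \<le> Suc (length (contract w))"
  by (induction w rule: contract.induct) auto

lemma contract_expand: "2 \<le> length w \<Longrightarrow> contract (expand w) = w"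
  and length_expand: "length w \<le> Suc (length (expand w))"
  by (induction w rule: expand.induct) auto

lemma thompson_word:
  assumes "cuntz_family s" "2 \<le> length w"
  shows "thompson s * cuntz_word s w = cuntz_word s (contract w)"
    "star (thompson s) * cuntz_word s w = cuntz_word s (expand w)"
proof -
  have [simp]: "star (s a) * s a = 1" "star (s a) * (s a * x) = x"
    "star (s I1) * s I2 = 0" "star (s I2) * s I1 = 0" for a x
    using cuntz_family_isometry[OF assms(1)] cuntz_family_orthogonal[OF assms(1)]
    by (simp_all add: mult.assoc[symmetric])
  have [simp]: "star (s I1) * (s I2 * x) = 0" "star (s I2) * (s I1 * x) = 0" for x
    by (simp_all add: mult.assoc[symmetric])
  obtain a b v where w: "w = a # b # v"
    using assms(2) by (cases w rule: list.exhaust; cases "tl w") auto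
  show "thompson s * cuntz_word s w = cuntz_word s (contract w)"
    "star (thompson s) * cuntz_word s w = cuntz_word s (expand w)"
    unfolding w by (cases a; cases b;
        simp add: thompson_def star_add star_mult star_star distrib_right mult.assoc)+
qed

section \<open>Thompson unitaries in the tensor coordinates\<close>

context commuting_cuntz_families
begin

abbreviation W :: "nat \<Rightarrow> 'a" where
  "W i \<equiv> thompson (T i)"

definition ones :: "(nat \<Rightarrow> nat) \<Rightarrow> 'a" where
  "ones \<kappa> = S (\<lambda>i. replicate (\<kappa> i) I1)"

text \<open>The final \<open>I2\<close> makes these cylinders pairwise disjoint, unlike those of
  \<open>ones\<close>, and \<open>W i\<close> lowers \<open>\<kappa> i\<close> by one while it is at
  least 2. Monomials in the \<open>W i\<close> thus act by translating exponents.\<close>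

definition marked_ones :: "(nat \<Rightarrow> nat) \<Rightarrow> 'a" where
  "marked_ones \<kappa> = S (\<lambda>i. replicate (\<kappa> i) I1 @ [I2])"

text \<open>The clopen projections satisfying this predicate are those containing the point with all
  coordinates \<open>111\<dots>\<close>, a common fixed point of all \<open>W i\<close>.\<close>

definition at_ones :: "'a \<Rightarrow> bool" where
  "at_ones q \<longleftrightarrow> (\<exists>L. \<forall>\<kappa>. (\<forall>i<m. L \<le> \<kappa> i) \<longrightarrow> q * ones \<kappa> = ones \<kappa>)"

lemma S_update:
  assumes i: "i < m"
    and comm: "\<And>j w. j < m \<Longrightarrow> j \<noteq> i \<Longrightarrow> x * cuntz_word (T j) w = cuntz_word (T j) w * x"
    and x: "x * cuntz_word (T i) (\<nu> i) = cuntz_word (T i) v"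
  shows "x * S \<nu> = S (\<nu>(i := v))"
proof -
  have "x * S \<nu> = ordered_prod (\<lambda>j. if j = i then x else 1) m * S \<nu>"
    by (simp add: ordered_prod_single[OF i])
  also have "\<dots> = ordered_prod (\<lambda>j. (if j = i then x else 1) * cuntz_word (T j) (\<nu> j)) m"
    unfolding S_def by (rule ordered_prod_mult) (use comm in auto)
  also have "\<dots> = S (\<nu>(i := v))"
    unfolding S_def by (rule ordered_prod_cong) (use x in auto)
  finally show ?thesis .
qed

lemma W_S:
  assumes i: "i < m" and len: "2 \<le> length (\<nu> i)"
  shows "W i * S \<nu> = S (\<nu>(i := contract (\<nu> i)))"
    "star (W i) * S \<nu> = S (\<nu>(i := expand (\<nu> i)))"
proof -
  have *: "W i * cuntz_word (T j) w = cuntz_word (T j) w * W i"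
    "star (W i) * cuntz_word (T j) w = cuntz_word (T j) w * star (W i)" if j: "j < m" "j \<noteq> i" for j w
  proof -
    define z where "z = cuntz_word (T j) w"
    have T: "T i a * z = z * T i a" "star (T i a) * z = z * star (T i a)" for a
      using word_comm[OF i j(1), of "[a]" w] word_comm_star[OF i j(1), of "[a]" w] j(2)
      by (simp_all add: z_def)
    have mult: "x * y * z = z * (x * y)" if "x * z = z * x" "y * z = z * y" for x y
      using that by (metis mult.assoc)
    show "W i * z = z * W i" "star (W i) * z = z * star (W i)"
      unfolding thompson_def star_add star_mult star_star distrib_left distrib_right
      by (intro arg_cong2[where f = "(+)"] mult T)+
  qed
  show "W i * S \<nu> = S (\<nu>(i := contract (\<nu> i)))" "star (W i) * S \<nu> = S (\<nu>(i := expand (\<nu> i)))"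
    by (rule S_update[OF i]; use * thompson_word[OF family[OF i] len] in simp)+
qed

lemma W_unitary:
  assumes i: "i < m"
  shows "star (W i) * W i = 1" "W i * star (W i) = 1"
proof -
  \<comment> \<open>Depth 3 leaves length at least 2 after the inner unitary has removed a
    letter.\<close>
  have "star (W i) * W i * S \<nu> = 1 * S \<nu> \<and> W i * star (W i) * S \<nu> = 1 * S \<nu>" if "long 3 \<nu>" for \<nu>
  proof -
    have "3 \<le> length (\<nu> i)" using that i by (simp add: long_def)
    then show ?thesis
      using length_contract[of "\<nu> i"] length_expand[of "\<nu> i"]
      by (simp add: mult.assoc W_S[OF i] expand_contract contract_expand)
  qed
  then show "star (W i) * W i = 1" "W i * star (W i) = 1"
    by (meson eq_if_eq_on_long)+
qed

text \<open>Covers \<open>W i\<close> and its adjoint at once. As \<open>V\<close> shortens words by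
  at most one letter, depth \<open>Suc L\<close> before \<open>V\<close> guarantees depth
  \<open>L\<close> after it.\<close>

lemma clopen_conjugate:
  assumes UV: "U * V = 1"
    and V: "\<And>\<nu>. long K \<nu> \<Longrightarrow> \<exists>\<nu>'. V * S \<nu> = S \<nu>' \<and> (\<forall>j<m. length (\<nu> j) \<le> Suc (length (\<nu>' j)))"
    and q: "clopen q"
  shows "clopen (U * q * V)"
proof -
  obtain L where L: "\<And>\<nu>. long L \<nu> \<Longrightarrow> q * S \<nu> = 0 \<or> q * S \<nu> = S \<nu>"
    using q by (auto simp: clopen_def)
  have "U * q * V * S \<nu> = 0 \<or> U * q * V * S \<nu> = S \<nu>" if \<nu>: "long (max K (Suc L)) \<nu>" for \<nu>
  proof -
    obtain \<nu>' where \<nu>': "V * S \<nu> = S \<nu>'" "\<forall>j<m. length (\<nu> j) \<le> Suc (length (\<nu>' j))"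
      using V[of \<nu>] long_mono[OF \<nu>] by auto
    have "long L \<nu>'" using \<nu> \<nu>'(2) by (fastforce simp: long_def)
    then have "q * (V * S \<nu>) = 0 \<or> q * (V * S \<nu>) = V * S \<nu>" using L \<nu>'(1) by simp
    moreover have "U * (V * S \<nu>) = S \<nu>" using UV by (simp add: mult.assoc[symmetric])
    ultimately show ?thesis by (auto simp: mult.assoc)
  qed
  then show ?thesis by (auto simp: clopen_def)
qed

lemma W_normalizing:
  assumes i: "i < m"
  shows "normalizing (W i)"
  unfolding normalizing_def
proof (intro conjI allI impI W_unitary[OF i])
  fix q assume q: "clopen q"
  have "\<exists>\<nu>'. star (W i) * S \<nu> = S \<nu>' \<and> (\<forall>j<m. length (\<nu> j) \<le> Suc (length (\<nu>' j)))"
    "\<exists>\<nu>'. W i * S \<nu> = S \<nu>' \<and> (\<forall>j<m. length (\<nu> j) \<le> Suc (length (\<nu>' j)))" if "long 2 \<nu>" for \<nu>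
  proof -
    have len: "2 \<le> length (\<nu> i)" using that i by (simp add: long_def)
    show "\<exists>\<nu>'. star (W i) * S \<nu> = S \<nu>' \<and> (\<forall>j<m. length (\<nu> j) \<le> Suc (length (\<nu>' j)))"
      by (rule exI[of _ "\<nu>(i := expand (\<nu> i))"]) (use W_S(2)[of i \<nu>] i len length_expand in simp)
    show "\<exists>\<nu>'. W i * S \<nu> = S \<nu>' \<and> (\<forall>j<m. length (\<nu> j) \<le> Suc (length (\<nu>' j)))"
      by (rule exI[of _ "\<nu>(i := contract (\<nu> i))"]) (use W_S(1)[of i \<nu>] i len length_contract in simp)
  qed
  then show "clopen (W i * q * star (W i))" "clopen (star (W i) * q * W i)"
    using clopen_conjugate q W_unitary[OF i] by blast+
qed

section \<open>The ultrafilter at the common fixed point\<close>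

lemma at_ones_mult:
  assumes "at_ones q" "at_ones r"
  shows "at_ones (q * r)"
proof -
  obtain K L where "\<And>\<kappa>. (\<forall>i<m. K \<le> \<kappa> i) \<Longrightarrow> q * ones \<kappa> = ones \<kappa>" "\<And>\<kappa>. (\<forall>i<m. L \<le> \<kappa> i) \<Longrightarrow> r * ones \<kappa> = ones \<kappa>"
    using assms by (auto simp: at_ones_def)
  then have "\<forall>\<kappa>. (\<forall>i<m. max K L \<le> \<kappa> i) \<longrightarrow> q * r * ones \<kappa> = ones \<kappa>"
    by (simp add: mult.assoc)
  then show ?thesis unfolding at_ones_def by blast
qed

text \<open>All \<open>ones \<kappa>\<close> with exponents at least \<open>L\<close> extend the
  single word with \<open>L\<close> letters \<open>I1\<close> in each coordinate, on which
  \<open>q\<close> is already 0 or 1.\<close>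

lemma at_ones_complement:
  assumes "clopen q"
  shows "at_ones q \<or> at_ones (1 - q)"
proof -
  obtain L where L: "\<And>\<nu>. long L \<nu> \<Longrightarrow> q * S \<nu> = 0 \<or> q * S \<nu> = S \<nu>"
    using assms by (auto simp: clopen_def)
  define o0 where "o0 = ones (\<lambda>_. L)"
  have ext: "ones \<kappa> = o0 * ones (\<lambda>i. \<kappa> i - L)" if "\<forall>i<m. L \<le> \<kappa> i" for \<kappa>
    unfolding ones_def o0_def S_mappend[symmetric]
    by (rule S_cong) (use that in \<open>simp add: mappend_def replicate_add[symmetric]\<close>)
  have "q * o0 = 0 \<or> q * o0 = o0" unfolding o0_def ones_def by (rule L) (simp add: long_def)
  then show ?thesis
  proof
    assume z: "q * o0 = 0"
    have "(1 - q) * ones \<kappa> = ones \<kappa>" if "\<forall>i<m. L \<le> \<kappa> i" for \<kappa>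
      using z ext[OF that] by (simp add: left_diff_distrib mult.assoc[symmetric])
    then show ?thesis unfolding at_ones_def by blast
  next
    assume z: "q * o0 = o0"
    have "q * ones \<kappa> = ones \<kappa>" if "\<forall>i<m. L \<le> \<kappa> i" for \<kappa>
      using z ext[OF that] by (simp add: mult.assoc[symmetric])
    then show ?thesis unfolding at_ones_def by blast
  qed
qed

lemma not_at_ones_0: "\<not> at_ones 0"
proof
  assume "at_ones 0"
  then obtain L where "ones (\<lambda>_. L) = 0" by (auto simp: at_ones_def)
  then show False by (simp add: ones_def)
qed

lemma W_ones:
  assumes i: "i < m" and "2 \<le> \<kappa> i"
  shows "W i * ones \<kappa> = ones (\<kappa>(i := \<kappa> i - 1))" "star (W i) * ones \<kappa> = ones (\<kappa>(i := Suc (\<kappa> i)))"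
proof -
  obtain l where l: "\<kappa> i = Suc (Suc l)" using assms(2) by (metis add_2_eq_Suc le_Suc_ex)
  show "W i * ones \<kappa> = ones (\<kappa>(i := \<kappa> i - 1))" "star (W i) * ones \<kappa> = ones (\<kappa>(i := Suc (\<kappa> i)))"
    unfolding ones_def by (simp_all add: W_S[OF i] l) (auto intro!: S_cong simp: l)
qed

lemma at_ones_conjugate:
  assumes i: "i < m" and q: "at_ones q"
  shows "at_ones (W i * q * star (W i))" "at_ones (star (W i) * q * W i)"
proof -
  obtain L where L: "\<And>\<kappa>. (\<forall>i<m. L \<le> \<kappa> i) \<Longrightarrow> q * ones \<kappa> = ones \<kappa>"
    using q by (auto simp: at_ones_def)
  \<comment> \<open>The margin 2 keeps all exponents at least \<open>L\<close> after lowering one of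
    them and meets the hypothesis of \<open>W_ones\<close>.\<close>
  have "W i * q * star (W i) * ones \<kappa> = ones \<kappa> \<and> star (W i) * q * W i * ones \<kappa> = ones \<kappa>"
    if \<kappa>: "\<forall>i<m. L + 2 \<le> \<kappa> i" for \<kappa>
  proof -
    have \<kappa>i: "L + 2 \<le> \<kappa> i" using \<kappa> i by blast
    have "q * ones (\<kappa>(i := Suc (\<kappa> i))) = ones (\<kappa>(i := Suc (\<kappa> i)))"
      "q * ones (\<kappa>(i := \<kappa> i - 1)) = ones (\<kappa>(i := \<kappa> i - 1))"
      by (rule L; use \<kappa> in fastforce)+
    then have "q * (star (W i) * ones \<kappa>) = star (W i) * ones \<kappa>" "q * (W i * ones \<kappa>) = W i * ones \<kappa>"
      using W_ones[OF i, of \<kappa>] \<kappa>i by simp_all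
    then have "W i * q * star (W i) * ones \<kappa> = (W i * star (W i)) * ones \<kappa>"
      "star (W i) * q * W i * ones \<kappa> = (star (W i) * W i) * ones \<kappa>"
      by (simp_all only: mult.assoc)
    then show ?thesis by (simp add: W_unitary[OF i])
  qed
  then show "at_ones (W i * q * star (W i))" "at_ones (star (W i) * q * W i)"
    unfolding at_ones_def by blast+
qed

text \<open>Strictness leaves at least one \<open>I1\<close> before the marker; a further step would
  turn \<open>12\<close> into \<open>21\<close>.\<close>

lemma W_power_marked_ones:
  assumes "i < m" "k < \<kappa> i"
  shows "W i ^ k * marked_ones \<kappa> = marked_ones (\<kappa>(i := \<kappa> i - k))"
  using assms(2)
proof (induction k)
  case (Suc k)
  define \<kappa>' where "\<kappa>' = \<kappa>(i := \<kappa> i - k)"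
  obtain l where l: "\<kappa>' i = Suc (Suc l)" "\<kappa> i - Suc k = Suc l"
    using Suc.prems by (intro that[of "\<kappa> i - k - 2"]) (auto simp: \<kappa>'_def)
  have "W i ^ Suc k * marked_ones \<kappa> = W i * marked_ones \<kappa>'"
    using Suc.IH[OF Suc_lessD[OF Suc.prems]] by (simp only: power_Suc mult.assoc \<kappa>'_def)
  also have "\<dots> = marked_ones (\<kappa>(i := \<kappa> i - Suc k))"
    unfolding marked_ones_def by (simp add: W_S[OF assms(1)] l) (auto intro!: S_cong simp: \<kappa>'_def l(2) simp del: diff_Suc_Suc)
  finally show ?case .
qed simp

lemma ordered_prod_W_marked_ones:
  assumes "p \<le> m" "\<And>i. i < p \<Longrightarrow> k i < \<kappa> i"
  shows "ordered_prod (\<lambda>i. W i ^ k i) p * marked_ones \<kappa> = marked_ones (\<lambda>i. if i < p then \<kappa> i - k i else \<kappa> i)"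
  using assms
proof (induction p arbitrary: \<kappa>)
  case (Suc p)
  have "ordered_prod (\<lambda>i. W i ^ k i) (Suc p) * marked_ones \<kappa>
      = ordered_prod (\<lambda>i. W i ^ k i) p * marked_ones (\<kappa>(p := \<kappa> p - k p))"
    using Suc.prems by (simp add: mult.assoc W_power_marked_ones)
  also have "\<dots> = marked_ones (\<lambda>i. if i < p then (\<kappa>(p := \<kappa> p - k p)) i - k i else (\<kappa>(p := \<kappa> p - k p)) i)"
    using Suc.prems by (intro Suc.IH) auto
  also have "\<dots> = marked_ones (\<lambda>i. if i < Suc p then \<kappa> i - k i else \<kappa> i)"
    by (rule arg_cong[where f = marked_ones]) (auto simp: fun_eq_iff less_Suc_eq)
  finally show ?case .
qed simp

text \<open>In coordinate \<open>i\<close>, the shorter word ends in \<open>I2\<close> where the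
  longer one still has \<open>I1\<close>.\<close>

lemma marked_ones_orthogonal:
  assumes "i < m" "\<kappa> i \<noteq> \<kappa>' i"
  shows "star (marked_ones \<kappa>) * marked_ones \<kappa>' = 0"
proof -
  have le: "star (marked_ones \<kappa>) * marked_ones \<kappa>' = 0" if "\<kappa> i < \<kappa>' i" for \<kappa> \<kappa>'
    unfolding marked_ones_def
  proof (rule S_orthogonal[OF assms(1)])
    have "take (length (replicate (\<kappa> i) I1 @ [I2])) (replicate (\<kappa>' i) I1 @ [I2]) = replicate (Suc (\<kappa> i)) I1"
      using that by (simp add: take_replicate min_def)
    moreover have "last (replicate (Suc (\<kappa> i)) I1) \<noteq> I2" by simp
    ultimately show "take (length (replicate (\<kappa> i) I1 @ [I2])) (replicate (\<kappa>' i) I1 @ [I2]) \<noteq> replicate (\<kappa> i) I1 @ [I2]"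
      by (metis last_snoc)
  qed (use that in simp)
  show ?thesis
  proof (cases "\<kappa> i < \<kappa>' i")
    case False
    then have "star (marked_ones \<kappa>') * marked_ones \<kappa> = 0" using assms(2) by (intro le) simp
    then show ?thesis by (metis star_mult star_star star_zero)
  qed (rule le)
qed

lemma marked_ones_isometry: "star (marked_ones \<kappa>) * marked_ones \<kappa> = 1"
  by (simp add: marked_ones_def)

lemma at_ones_marked_ones:
  assumes "at_ones q"
  shows "\<exists>L. \<forall>l\<ge>L. q * marked_ones (\<lambda>_. l) = marked_ones (\<lambda>_. l)"
proof -
  obtain L where L: "\<And>\<kappa>. (\<forall>i<m. L \<le> \<kappa> i) \<Longrightarrow> q * ones \<kappa> = ones \<kappa>"
    using assms by (auto simp: at_ones_def)
  have "marked_ones \<kappa> = ones \<kappa> * S (\<lambda>_. [I2])" for \<kappa>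
    unfolding marked_ones_def ones_def S_mappend[symmetric] by (simp add: mappend_def[abs_def])
  then show ?thesis using L by (intro exI[of _ L]) (simp add: mult.assoc[symmetric])
qed

end

section \<open>Transport along an isomorphism\<close>

lemma star_hom_one:
  assumes "star_hom \<phi>" "surj \<phi>"
  shows "\<phi> 1 = 1"
proof -
  obtain x where x: "\<phi> x = 1" using assms(2) by (metis surjD)
  then have "1 = \<phi> (x * 1)" by simp
  also have "\<dots> = \<phi> x * \<phi> 1" using assms(1) by (simp only: star_hom_def)
  finally show ?thesis using x by simp
qed

lemma star_isomorphism_inv:
  assumes "star_isomorphism \<phi>"
  shows "star_isomorphism (inv \<phi>)"
proof -
  have b: "bij \<phi>" and h: "star_hom \<phi>" using assms by (auto simp: star_isomorphism_def)
  have [simp]: "inv \<phi> (\<phi> x) = x" "\<phi> (inv \<phi> y) = y" for x y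
    using b by (simp_all add: bij_is_inj bij_is_surj surj_f_inv_f)
  have eq: "inv \<phi> y = x" if "\<phi> x = y" for x y using that by auto
  show ?thesis unfolding star_isomorphism_def star_hom_def
    using b h by (auto simp: bij_imp_bij_inv star_hom_def intro!: eq)
qed

lemma star_hom_power: "star_hom \<phi> \<Longrightarrow> \<phi> 1 = 1 \<Longrightarrow> \<phi> (x ^ k) = \<phi> x ^ k"
  by (induction k) (auto simp: star_hom_def)

lemma star_hom_prod_list: "star_hom \<phi> \<Longrightarrow> \<phi> 1 = 1 \<Longrightarrow> \<phi> (prod_list xs) = prod_list (map \<phi> xs)"
  by (induction xs) (auto simp: star_hom_def)

lemma star_hom_ordered_prod:
  "star_hom \<phi> \<Longrightarrow> \<phi> 1 = 1 \<Longrightarrow> \<phi> (ordered_prod f n) = ordered_prod (\<lambda>i. \<phi> (f i)) n"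
  by (simp add: ordered_prod_def star_hom_prod_list comp_def)

text \<open>Density of words is assumed on the source side, where normalizers must be approximated;
  the target supplies explicit unitaries and the point \<open>111...\<close>, both pulled back along
  \<open>\<phi>\<close>. A relation between two monomials near this point is refuted by a marked
  cylinder that they move to orthogonal places.\<close>

lemma no_diagonal_isomorphism:
  fixes T :: "nat \<Rightarrow> cuntz_index \<Rightarrow> 'a :: unital_cstar_algebra"
    and T' :: "nat \<Rightarrow> cuntz_index \<Rightarrow> 'b :: unital_cstar_algebra"
  assumes A: "cuntz_system m T" and B: "commuting_cuntz_families n T'" and "m < n"
    and iso: "star_isomorphism \<phi>"
    and diag: "\<phi> ` commuting_cuntz_families.diagonal m T = commuting_cuntz_families.diagonal n T'"
  shows False
proof -
  interpret A: cuntz_system m T by fact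
  interpret B: commuting_cuntz_families n T' by fact
  have hom: "star_hom \<phi>" and "inj \<phi>" and surj: "surj \<phi>"
    using iso by (auto simp: star_isomorphism_def bij_def)
  have one [simp]: "\<phi> 1 = 1" by (rule star_hom_one[OF hom surj])
  have [simp]: "\<phi> (x * y) = \<phi> x * \<phi> y" "\<phi> (star x) = star (\<phi> x)" for x y
    using hom by (auto simp: star_hom_def)
  have diff [simp]: "\<phi> (x - y) = \<phi> x - \<phi> y" for x y by (rule star_hom_diff[OF hom])
  have zero [simp]: "\<phi> 0 = 0" using diff[of 0 0] by simp
  have eq_iff: "\<phi> x = \<phi> y \<longleftrightarrow> x = y" for x y using \<open>inj \<phi>\<close> by (auto dest: injD)
  have cl: "B.clopen (\<phi> q) \<longleftrightarrow> A.clopen q" for q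
  proof -
    have "\<phi> q \<in> B.diagonal \<longleftrightarrow> q \<in> A.diagonal"
      using diag \<open>inj \<phi>\<close> by (metis inj_image_mem_iff)
    moreover have "\<phi> q * \<phi> q = \<phi> q \<longleftrightarrow> q * q = q" "star (\<phi> q) = \<phi> q \<longleftrightarrow> star q = q"
      using eq_iff[of "q * q" q] eq_iff[of "star q" q] by simp_all
    ultimately show ?thesis
      by (simp add: A.clopen_iff_diagonal_projection B.clopen_iff_diagonal_projection)
  qed
  define \<psi> where "\<psi> = inv \<phi>"
  have \<psi> [simp]: "\<phi> (\<psi> y) = y" for y by (simp add: \<psi>_def surj surj_f_inv_f)
  \<comment> \<open>The ultrafilter at \<open>111...\<close> is pulled back from the target; which
    point of the source it is remains unknown.\<close>
  interpret A: cuntz_ultrafilter m T "\<lambda>q. B.at_ones (\<phi> q)"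
    by unfold_locales
      (use B.at_ones_mult B.at_ones_complement B.not_at_ones_0 cl in auto)
  define V where "V j = \<psi> (B.W j)" for j
  have V: "A.stabilizing (V j)" if "j < n" for j
    unfolding A.stabilizing_def A.normalizing_def
    using B.W_normalizing[OF that] B.at_ones_conjugate[OF that]
    by (simp add: V_def B.normalizing_def cl[symmetric] eq_iff[symmetric])
  define U where "U k = ordered_prod (\<lambda>j. V j ^ k j) n" for k
  obtain k k' \<nu> j where j: "j < n" "k j \<noteq> k' j" and \<nu>: "B.at_ones (\<phi> (A.P \<nu>))"
    and U: "\<And>\<eta>. U k * A.P (\<nu> \<diamond> \<eta>) * star (U k) = U k' * A.P (\<nu> \<diamond> \<eta>) * star (U k')"
    using A.stabilizer_relation[OF \<open>m < n\<close>, of V] V unfolding U_def by blast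
  obtain L where L: "\<And>l. L \<le> l \<Longrightarrow> \<phi> (A.P \<nu>) * B.marked_ones (\<lambda>_. l) = B.marked_ones (\<lambda>_. l)"
    using B.at_ones_marked_ones[OF \<nu>] by blast
  \<comment> \<open>Beyond \<open>L\<close>, so that the marked cylinder lies in
    \<open>\<phi> (A.P \<nu>)\<close>, and strictly above all exponents, so that every translation
    is defined.\<close>
  define l where "l = L + (\<Sum>j<n. k j + k' j) + 1"
  have l: "k i < l" "k' i < l" if "i < n" for i
  proof -
    have "k i + k' i \<le> (\<Sum>j<n. k j + k' j)"
      using that by (intro member_le_sum[of i "{..<n}" "\<lambda>j. k j + k' j"]) auto
    then show "k i < l" "k' i < l" by (auto simp: l_def)
  qed
  define X where "X = B.marked_ones (\<lambda>_. l)"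
  have X: "star X * X = 1" by (simp add: X_def B.marked_ones_isometry)
  have UX: "\<phi> (U h) * X = B.marked_ones (\<lambda>i. if i < n then l - h i else l)" if "\<And>i. i < n \<Longrightarrow> h i < l" for h
    using that B.ordered_prod_W_marked_ones[of n h "\<lambda>_. l"]
    by (simp add: U_def X_def star_hom_ordered_prod[OF hom one] star_hom_power[OF hom one] V_def)
  have orth: "star (\<phi> (U k) * X) * (\<phi> (U k') * X) = 0"
  proof -
    have "\<phi> (U k) * X = B.marked_ones (\<lambda>i. if i < n then l - k i else l)"
      "\<phi> (U k') * X = B.marked_ones (\<lambda>i. if i < n then l - k' i else l)"
      by (rule UX; rule l; assumption)+
    then show ?thesis
      using j l[OF j(1)] by (auto intro!: B.marked_ones_orthogonal[OF j(1)])
  qed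
  \<comment> \<open>The preimage of the marked cylinder need not be a cylinder of the source; it is
    replaced by a source cylinder \<open>\<nu> \<diamond> \<eta>\<close> inside it.\<close>
  define q where "q = \<psi> (X * star X)"
  have q: "A.clopen q" "q \<noteq> 0" "q * A.P \<nu> = q"
  proof -
    have cX: "B.clopen (X * star X)"
      using B.clopen_P[of "\<lambda>i. replicate l I1 @ [I2]"] by (simp add: X_def B.marked_ones_def B.P_def)
    then show "A.clopen q" by (simp add: q_def cl[symmetric])
    have "X * star X * X \<noteq> 0"
      using X by (simp add: mult.assoc) (auto simp: X_def B.marked_ones_def)
    then have "X * star X \<noteq> 0" by auto
    then show "q \<noteq> 0" by (auto simp: q_def eq_iff[symmetric])
    have "\<phi> (A.P \<nu>) * (X * star X) = X * star X"
      using L[of l] by (simp add: X_def l_def mult.assoc[symmetric])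
    moreover have "B.clopen (\<phi> (A.P \<nu>))" using cl A.clopen_P by blast
    ultimately have "X * star X * \<phi> (A.P \<nu>) = X * star X"
      using B.clopen_mult(2)[OF cX] by simp
    then show "q * A.P \<nu> = q" by (simp add: eq_iff[symmetric] q_def)
  qed
  obtain \<eta> where \<eta>: "q * A.S (\<nu> \<diamond> \<eta>) = A.S (\<nu> \<diamond> \<eta>)"
    using A.clopen_nonzero_below[OF q] .
  define t where "t = \<phi> (A.P (\<nu> \<diamond> \<eta>))"
  have "q * A.P (\<nu> \<diamond> \<eta>) = A.P (\<nu> \<diamond> \<eta>)"
    using \<eta> by (simp add: A.P_def mult.assoc[symmetric])
  then have "\<phi> (q * A.P (\<nu> \<diamond> \<eta>)) = t" by (simp add: t_def)
  then have Xt: "X * star X * t = t" by (simp add: t_def q_def)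
  have "star t = t" by (simp add: t_def A.P_selfadjoint flip: \<open>\<And>x. \<phi> (star x) = star (\<phi> x)\<close>)
  have "t \<noteq> 0" using eq_iff[of "A.P (\<nu> \<diamond> \<eta>)" 0] by (simp add: t_def)
  have unit: "star (\<phi> (U h)) * \<phi> (U h) = 1" for h
  proof -
    have "A.stabilizing (U h)"
      unfolding U_def using A.stabilizing_degree[OF V] A.degree_ordered_prod[of n V, OF V]
      by (metis (no_types, lifting))
    then have "star (U h) * U h = 1" using A.normalizing_unitary by (simp add: A.stabilizing_def)
    then have "\<phi> (star (U h) * U h) = \<phi> 1" by (rule arg_cong)
    then show ?thesis by simp
  qed
  have "\<phi> (U k * A.P (\<nu> \<diamond> \<eta>) * star (U k)) = \<phi> (U k' * A.P (\<nu> \<diamond> \<eta>) * star (U k'))" using U by simp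
  then have conj: "\<phi> (U k) * t * star (\<phi> (U k)) = \<phi> (U k') * t * star (\<phi> (U k'))" by (simp add: t_def)
  \<comment> \<open>Inserting the unitary \<open>\<phi> (U k)\<close> and exchanging
    \<open>k\<close> for \<open>k'\<close> by \<open>conj\<close> produces the factor
    \<open>star (\<phi> (U k) * X) * (\<phi> (U k') * X)\<close>, which vanishes by
    \<open>orth\<close>.\<close>
  have "star X * t = star X * (star (\<phi> (U k)) * \<phi> (U k)) * t * (star (\<phi> (U k)) * \<phi> (U k))"
    by (simp add: unit)
  also have "\<dots> = star X * star (\<phi> (U k)) * (\<phi> (U k) * t * star (\<phi> (U k))) * \<phi> (U k)"
    by (simp only: mult.assoc)
  also have "\<dots> = star X * star (\<phi> (U k)) * (\<phi> (U k') * (X * star X * t) * star (\<phi> (U k'))) * \<phi> (U k)"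
    by (simp only: conj Xt)
  also have "\<dots> = (star (\<phi> (U k) * X) * (\<phi> (U k') * X)) * star X * t * star (\<phi> (U k')) * \<phi> (U k)"
    by (simp only: mult.assoc star_mult)
  finally have "star X * t = 0" by (simp add: orth)
  then show False using Xt \<open>t \<noteq> 0\<close> by (simp add: mult.assoc)
qed

section \<open>Tensor powers of the Cuntz algebra\<close>

lemma elementary_tensor_ordered_prod:
  "elementary_tensor \<iota> xs = ordered_prod (\<lambda>i. \<iota> i (xs ! i)) (length xs)"
  by (simp add: elementary_tensor_def ordered_prod_def)

lemma ordered_prod_left_multipliers:
  "(\<And>i. i < n \<Longrightarrow> f i \<in> left_multipliers X) \<Longrightarrow> ordered_prod f n \<in> left_multipliers X"
  unfolding ordered_prod_def by (intro left_multipliers_prod_list) auto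

text \<open>Reduces statements about a whole tensor factor to a spanning set; contractivity of
  \<open>\<phi>\<close> makes the preimage of \<open>X\<close> closed.\<close>

lemma closed_preimage_subspace:
  assumes \<phi>: "star_hom \<phi>" "\<phi> 1 = 1" and X: "complex_vector.subspace X" "closed X"
    and Y: "\<And>y. y \<in> Y \<Longrightarrow> \<phi> y \<in> X" and x: "x \<in> closed_cspan Y"
  shows "\<phi> x \<in> X"
proof -
  have h: "\<phi> (x + y) = \<phi> x + \<phi> y" "\<phi> (c *\<^sub>C x) = c *\<^sub>C \<phi> x" for x y c
    using \<phi>(1) by (auto simp: star_hom_def)
  have "\<phi> 0 = 0" using star_hom_diff[OF \<phi>(1), of 0 0] by simp
  then have "complex_vector.subspace {x. \<phi> x \<in> X}"
    using X(1) by (auto intro!: complex_vector.subspaceI simp: h complex_vector.subspace_0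
        complex_vector.subspace_add complex_vector.subspace_scale)
  moreover have "closed (\<phi> -` X)"
    by (intro closed_vimage X star_hom_continuous \<phi>)
  then have "closed {x. \<phi> x \<in> X}" by (simp add: vimage_def)
  ultimately have "closed_cspan Y \<subseteq> {x. \<phi> x \<in> X}"
    using Y by (intro closed_cspan_minimal) auto
  with x show ?thesis by blast
qed

lemma range_free_eval: "range (free_eval s) \<subseteq> cspan (range (word_eval s))"
proof safe
  fix f
  show "free_eval s f \<in> cspan (range (word_eval s))"
    unfolding free_eval_def linear_ext_def
    by (intro complex_vector.span_sum complex_vector.span_scale complex_vector.span_base) simp
qed

context
  fixes n :: nat and s :: "cuntz_index \<Rightarrow> 'o :: unital_cstar_algebra"
    and \<iota> :: "nat \<Rightarrow> 'o \<Rightarrow> 'a :: unital_cstar_algebra"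
  assumes s: "is_cuntz_algebra s" and \<iota>: "is_cstar_tensor_power n \<iota>"
begin

lemma tensor_hom:
  assumes "i < n"
  shows "star_hom (\<iota> i)" "\<iota> i 1 = 1" "\<iota> i (x * y) = \<iota> i x * \<iota> i y" "\<iota> i (x + y) = \<iota> i x + \<iota> i y"
    "\<iota> i (star x) = star (\<iota> i x)"
  using \<iota> assms by (auto simp: is_cstar_tensor_power_def star_hom_def)

lemma tensor_power_families: "commuting_cuntz_families n (\<lambda>i a. \<iota> i (s a))"
proof
  fix i assume i: "i < n"
  have "star (s I1) * s I1 = 1" "star (s I2) * s I2 = 1" "s I1 * star (s I1) + s I2 * star (s I2) = 1"
    using s by (simp_all add: is_cuntz_algebra_def cuntz_family_def)
  note this[THEN arg_cong[of _ _ "\<iota> i"]]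
  then show "cuntz_family (\<lambda>a. \<iota> i (s a))"
    by (simp add: cuntz_family_def tensor_hom[OF i])
next
  fix i j a b assume ij: "i < n" "j < n" "i \<noteq> j"
  then have "\<iota> i x * \<iota> j y = \<iota> j y * \<iota> i x" for x y
    using \<iota> unfolding is_cstar_tensor_power_def by blast
  then show "\<iota> i (s a) * \<iota> j (s b) = \<iota> j (s b) * \<iota> i (s a)"
    "star (\<iota> i (s a)) * \<iota> j (s b) = \<iota> j (s b) * star (\<iota> i (s a))"
    using ij by (simp_all add: tensor_hom(5)[symmetric])
qed

interpretation A: commuting_cuntz_families n "\<lambda>i a. \<iota> i (s a)"
  by (rule tensor_power_families)

lemma tensor_hom_word: "i < n \<Longrightarrow> cuntz_word (\<lambda>a. \<iota> i (s a)) w = \<iota> i (cuntz_word s w)"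
  by (simp add: cuntz_word_def star_hom_prod_list[OF tensor_hom(1,2)] comp_def)

text \<open>A generator only lengthens \<open>\<mu>\<close>. For an adjoint, \<open>\<mu> i\<close>
  may be empty and leave nothing to cancel against; splitting 1 into the two halves of coordinate
  \<open>i\<close> supplies a letter.\<close>

lemma generator_left_multipliers:
  assumes i: "i < n"
  defines "C \<equiv> closed_cspan (range (\<lambda>(\<mu>, \<nu>). A.S \<mu> * star (A.S \<nu>)))"
  shows "\<iota> i (s a) \<in> left_multipliers C" "star (\<iota> i (s a)) \<in> left_multipliers C"
proof -
  have base: "A.S \<mu> * star (A.S \<nu>) \<in> C" for \<mu> \<nu>
    unfolding C_def by (rule closed_cspan_base) auto
  have sub: "complex_vector.subspace C" by (simp add: C_def closed_cspan_subspace)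
  have *: "y \<in> left_multipliers C" if "\<And>\<mu> \<nu>. y * (A.S \<mu> * star (A.S \<nu>)) \<in> C" for y
    unfolding left_multipliers_def C_def
    by (intro CollectI ballI, rule closed_cspan_mult_left) (use that in \<open>auto simp: C_def\<close>)
  have S: "A.S (letter_at i a) = \<iota> i (s a)" for a by (rule A.S_letter_at[OF i])
  show "\<iota> i (s a) \<in> left_multipliers C"
    by (rule *) (simp add: S[symmetric] mult.assoc[symmetric] A.S_mappend[symmetric] base del: fun_upd_apply)
  show "star (\<iota> i (s a)) \<in> left_multipliers C"
  proof (rule *)
    fix \<mu> \<nu>
    define F where "F b = star (A.S (letter_at i a)) * A.S (\<mu> \<diamond> letter_at i b) * star (A.S (\<nu> \<diamond> letter_at i b))" for b
    have "A.P (letter_at i I1) + A.P (letter_at i I2) = 1"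
      using A.P_split[OF i, of "\<lambda>_. []"] by (simp add: mappend_def[abs_def])
    then have "A.S \<mu> * star (A.S \<nu>) = A.S \<mu> * (A.P (letter_at i I1) + A.P (letter_at i I2)) * star (A.S \<nu>)"
      by simp
    also have "\<dots> = A.S (\<mu> \<diamond> letter_at i I1) * star (A.S (\<nu> \<diamond> letter_at i I1))
        + A.S (\<mu> \<diamond> letter_at i I2) * star (A.S (\<nu> \<diamond> letter_at i I2))"
      by (simp add: A.P_def A.S_mappend star_mult algebra_simps)
    finally have "star (\<iota> i (s a)) * (A.S \<mu> * star (A.S \<nu>)) = F I1 + F I2"
      by (simp add: F_def S[symmetric] distrib_left mult.assoc del: fun_upd_apply)
    moreover have "F b \<in> C" for b
    proof -
      have "star (A.S (letter_at i a)) * A.S (\<mu> \<diamond> letter_at i b) \<in> insert 0 (range A.S)"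
        by (rule A.star_S_mult_S_cases) (simp add: mappend_def)
      then show ?thesis
        unfolding F_def using base complex_vector.subspace_0[OF sub] by auto
    qed
    ultimately show "star (\<iota> i (s a)) * (A.S \<mu> * star (A.S \<nu>)) \<in> C"
      using complex_vector.subspace_add[OF sub] by simp
  qed
qed

lemma tensor_power_cuntz_system: "cuntz_system n (\<lambda>i a. \<iota> i (s a))"
proof
  define C where "C = closed_cspan (range (\<lambda>(\<mu>, \<nu>). A.S \<mu> * star (A.S \<nu>)))"
  have sub: "complex_vector.subspace (left_multipliers C)" "closed (left_multipliers C)"
    by (simp_all add: C_def closed_cspan_subspace closed_closed_cspan left_multipliers_subspace closed_left_multipliers)
  \<comment> \<open>Words in the generators and their adjoints are multipliers, and their span is
    dense in the factor.\<close>
  have mult: "\<iota> i x \<in> left_multipliers C" if i: "i < n" for i x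
  proof (rule closed_preimage_subspace[OF tensor_hom(1,2)[OF i] sub, of "range (word_eval s)"])
    fix y assume "y \<in> range (word_eval s)"
    then obtain w where y: "y = word_eval s w" by blast
    show "\<iota> i y \<in> left_multipliers C"
      unfolding y word_eval_def star_hom_prod_list[OF tensor_hom(1,2)[OF i]]
      by (rule left_multipliers_prod_list)
        (use generator_left_multipliers[OF i] in \<open>auto simp: C_def tensor_hom(5)[OF i]\<close>)
  next
    have "closure (range (free_eval s)) \<subseteq> closed_cspan (range (word_eval s))"
      unfolding closed_cspan_def by (rule closure_mono[OF range_free_eval])
    moreover have "closure (range (free_eval s)) = UNIV" using s by (simp add: is_cuntz_algebra_def)
    ultimately show "x \<in> closed_cspan (range (word_eval s))" by blast
  qed
  have "A.S (\<lambda>_. []) * star (A.S (\<lambda>_. [])) \<in> C"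
    unfolding C_def by (rule closed_cspan_base, rule image_eqI[of _ _ "(\<lambda>_. [], \<lambda>_. [])"]) simp_all
  then have "1 \<in> C" by (simp add: star_one)
  then have C: "y \<in> C" if "y \<in> left_multipliers C" for y
    using that by (metis (mono_tags, lifting) left_multipliers_def mem_Collect_eq mult_1_right)
  have "closed_cspan (elementary_tensor \<iota> ` {xs. length xs = n}) \<subseteq> C"
  proof (rule closed_cspan_minimal)
    show "elementary_tensor \<iota> ` {xs. length xs = n} \<subseteq> C"
      by (auto simp: elementary_tensor_ordered_prod intro!: C ordered_prod_left_multipliers mult)
  qed (simp_all add: C_def closed_cspan_subspace closed_closed_cspan)
  moreover have "closed_cspan (elementary_tensor \<iota> ` {xs. length xs = n}) = UNIV"
    using \<iota> by (simp add: is_cstar_tensor_power_def closed_cspan_def)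
  ultimately show "closed_cspan (range (\<lambda>(\<mu>, \<nu>). A.S \<mu> * star (A.S \<nu>))) = UNIV"
    by (auto simp: C_def)
qed

text \<open>A cylinder projection is the elementary tensor of its coordinate projections, which
  gives one inclusion. For the other, the diagonal of each factor multiplies
  \<open>A.diagonal\<close> into itself, and 1 lies in it.\<close>

lemma tensor_power_diagonal:
  "tensor_power_subspace n \<iota> (cuntz_diagonal s) = A.diagonal"
proof
  let ?p = "\<lambda>w. cuntz_word s w * star (cuntz_word s w)"
  have diag_s: "cuntz_diagonal s = closed_cspan (range ?p)"
    by (simp add: cuntz_diagonal_def closed_cspan_def)
  have tps: "tensor_power_subspace n \<iota> (cuntz_diagonal s)
      = closed_cspan (elementary_tensor \<iota> ` {xs. length xs = n \<and> set xs \<subseteq> cuntz_diagonal s})"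
    by (simp add: tensor_power_subspace_def closed_cspan_def)
  have sub: "complex_vector.subspace (left_multipliers A.diagonal)" "closed (left_multipliers A.diagonal)"
    by (simp_all add: A.diagonal_def closed_cspan_subspace closed_closed_cspan left_multipliers_subspace closed_left_multipliers)
  have P: "A.P \<kappa> \<in> left_multipliers A.diagonal" for \<kappa>
    unfolding left_multipliers_def A.diagonal_def
    by (intro CollectI ballI, rule closed_cspan_mult_left)
      (use A.clopen_in_diagonal[OF A.clopen_mult(1)[OF A.clopen_P A.clopen_P]] in \<open>auto simp: A.diagonal_def\<close>)
  have mult: "\<iota> i x \<in> left_multipliers A.diagonal" if i: "i < n" and x: "x \<in> cuntz_diagonal s" for i x
  proof (rule closed_preimage_subspace[OF tensor_hom(1,2)[OF i] sub _ x[unfolded diag_s]])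
    fix y assume "y \<in> range ?p"
    then obtain w where "y = ?p w" by blast
    then have "\<iota> i y = A.P ((\<lambda>_. [])(i := w))"
      by (simp add: A.P_def A.S_single[OF i] tensor_hom_word[OF i] tensor_hom[OF i] del: fun_upd_apply)
    then show "\<iota> i y \<in> left_multipliers A.diagonal" using P by simp
  qed
  have "1 \<in> A.diagonal" using A.clopen_in_diagonal A.clopen_1 by blast
  then have D: "y \<in> A.diagonal" if "y \<in> left_multipliers A.diagonal" for y
    using that by (metis (mono_tags, lifting) left_multipliers_def mem_Collect_eq mult_1_right)
  show "tensor_power_subspace n \<iota> (cuntz_diagonal s) \<subseteq> A.diagonal"
    unfolding tps
  proof (rule closed_cspan_minimal)
    show "elementary_tensor \<iota> ` {xs. length xs = n \<and> set xs \<subseteq> cuntz_diagonal s} \<subseteq> A.diagonal"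
    proof (rule image_subsetI)
      fix xs assume "xs \<in> {xs. length xs = n \<and> set xs \<subseteq> cuntz_diagonal s}"
      then have xs: "length xs = n" "\<And>i. i < n \<Longrightarrow> xs ! i \<in> cuntz_diagonal s"
        using nth_mem by blast+
      show "elementary_tensor \<iota> xs \<in> A.diagonal"
        unfolding elementary_tensor_ordered_prod xs(1)
        by (intro D ordered_prod_left_multipliers mult xs(2))
    qed
  qed (simp_all add: A.diagonal_def closed_cspan_subspace closed_closed_cspan)
  show "A.diagonal \<subseteq> tensor_power_subspace n \<iota> (cuntz_diagonal s)"
    unfolding tps A.diagonal_def
  proof (rule closed_cspan_minimal[OF _ closed_cspan_subspace closed_closed_cspan], rule image_subsetI)
    fix \<nu>
    have "A.P \<nu> = ordered_prod (\<lambda>i. cuntz_word (\<lambda>a. \<iota> i (s a)) (\<nu> i) * star (cuntz_word (\<lambda>a. \<iota> i (s a)) (\<nu> i))) n"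
      unfolding A.P_def A.star_S unfolding A.S_def
      by (rule ordered_prod_mult) (use A.word_comm_star in auto)
    also have "\<dots> = ordered_prod (\<lambda>i. \<iota> i (map (\<lambda>i. ?p (\<nu> i)) [0..<n] ! i)) n"
      by (rule ordered_prod_cong) (simp add: tensor_hom_word tensor_hom)
    also have "\<dots> = elementary_tensor \<iota> (map (\<lambda>i. ?p (\<nu> i)) [0..<n])"
      by (simp add: elementary_tensor_ordered_prod)
    finally have "A.P \<nu> = elementary_tensor \<iota> (map (\<lambda>i. ?p (\<nu> i)) [0..<n])" .
    moreover have "?p w \<in> cuntz_diagonal s" for w unfolding diag_s by (rule closed_cspan_base) blast
    ultimately show "A.P \<nu> \<in> closed_cspan (elementary_tensor \<iota> ` {xs. length xs = n \<and> set xs \<subseteq> cuntz_diagonal s})"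
      by (intro closed_cspan_base image_eqI) auto
  qed
qed

end

theorem theorem8p12:
  fixes m n :: nat
    and s :: "cuntz_index \<Rightarrow> 'o :: unital_cstar_algebra"
    and \<iota> :: "nat \<Rightarrow> 'o \<Rightarrow> 'a :: unital_cstar_algebra"
    and \<kappa> :: "nat \<Rightarrow> 'o \<Rightarrow> 'b :: unital_cstar_algebra"
  assumes "m \<ge> 1" and "n \<ge> 1" and "m \<noteq> n"
    and "is_cuntz_algebra s"
    and "is_cstar_tensor_power m \<iota>"
    and "is_cstar_tensor_power n \<kappa>"
  shows "\<not> (\<exists>\<phi> :: 'a \<Rightarrow> 'b. star_isomorphism \<phi> \<and>
      \<phi> ` tensor_power_subspace m \<iota> (cuntz_diagonal s)
        = tensor_power_subspace n \<kappa> (cuntz_diagonal s))"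
proof
  assume "\<exists>\<phi> :: 'a \<Rightarrow> 'b. star_isomorphism \<phi> \<and>
      \<phi> ` tensor_power_subspace m \<iota> (cuntz_diagonal s)
        = tensor_power_subspace n \<kappa> (cuntz_diagonal s)"
  then obtain \<phi> :: "'a \<Rightarrow> 'b" where iso: "star_isomorphism \<phi>"
    and eq: "\<phi> ` tensor_power_subspace m \<iota> (cuntz_diagonal s)
        = tensor_power_subspace n \<kappa> (cuntz_diagonal s)"
    by blast
  note A = tensor_power_cuntz_system[OF assms(4,5)] tensor_power_diagonal[OF assms(4,5)]
  note B = tensor_power_cuntz_system[OF assms(4,6)] tensor_power_diagonal[OF assms(4,6)]
  consider "m < n" | "n < m" using \<open>m \<noteq> n\<close> by linarith
  then show False
  proof cases
    case 1
    show False
      by (rule no_diagonal_isomorphism[OF A(1) tensor_power_families[OF assms(4,6)] 1 iso])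
        (use eq in \<open>simp only: A(2) B(2)\<close>)
  next
    case 2
    have "inj \<phi>" using iso by (simp add: star_isomorphism_def bij_is_inj)
    then have eq': "inv \<phi> ` tensor_power_subspace n \<kappa> (cuntz_diagonal s)
        = tensor_power_subspace m \<iota> (cuntz_diagonal s)"
      unfolding eq[symmetric] by (simp add: image_inv_f_f)
    show False
      by (rule no_diagonal_isomorphism[OF B(1) tensor_power_families[OF assms(4,5)] 2 star_isomorphism_inv[OF iso]])
        (use eq' in \<open>simp only: A(2) B(2)\<close>)
  qed
qed

end
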